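(* There is an isomorphism of set operads $$\overline{\wp}(\mathit{Perm})\cong\mathit{ComTrias}.$$
   Context: A set operad is a symmetric operad in sets, described by partial compositions $\circ_i$. For $n\ge1$ put $[n]=\{1,\dots,n\}$. The permutative operad $\mathit{Perm}$ has $\mathit{Perm}(0)=\emptyset$ and $\mathit{Perm}(n)=[n]$ for $n\ge 1$, with the natural action of $\mathbb{S}_n$, and for $i\in\mathit{Perm}(n)$, $j\in\mathit{Perm}(m)$, $k\in[n]$: $i\circ_k j=i+m-1$ if $k<i$; $i\circ_k j=i+j-1$ if $k=i$; $i\circ_k j=i$ if $k>i$. For a set operad $\mathcal{O}$, the operad $\overline{\wp}(\mathcal{O})$ has $\overline{\wp}(\mathcal{O})(n)$ equal to the set of non-empty subsets of $\mathcal{O}(n)$, with compositions $A\circ_i B=\{a\circ_i b\mid a\in A,b\in B\}$ and the induced symmetric group actions. The commutative triassociative operad $\mathit{ComTrias}$ is the set operad presented as the quotient of the free symmetric operad on three binary operations $\dashv,\vdash,\perp$, where the transposition $(12)$ exchanges $\dashv$ and $\vdash$ and fixes $\perp$, by the following 11 relations: $\dashv\circ_1\dashv\ \equiv\ \dashv\circ_2\dashv\ \equiv\ \dashv\circ_2\vdash\ \equiv\ \dashv\circ_2\perp$; $\vdash\circ_2\vdash\ \equiv\ \vdash\circ_1\dashv\ \equiv\ \vdash\circ_1\vdash\ \equiv\ \vdash\circ_1\perp$; $\dashv\circ_1\vdash\ \equiv\ \vdash\circ_2\dashv$; $\perp\circ_1\dashv\ \equiv\ \perp\circ_2\vdash$;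 $\perp\circ_1\vdash\ \equiv\ \vdash\circ_2\perp$; $\dashv\circ_1\perp\ \equiv\ \perp\circ_2\dashv$; $\perp\circ_1\perp\ \equiv\ \perp\circ_2\perp$. *)

theory Defs
  imports "HOL-Combinatorics.Permutations"
begin

section \<open>Symmetric set operads\<close>

text \<open>
  The sets of operations of different arities need not be disjoint, so partial composition and
  action take arities as arguments: \<open>pcomp P n m i a b\<close> is $a \circ_i b$ for an $n$-ary \<open>a\<close>
  and an $m$-ary \<open>b\<close>, and \<open>sact P n \<sigma> a\<close> is the action of \<open>\<sigma>\<close>, a permutation of
  \<open>{1..n}\<close>, on the $n$-ary operation \<open>a\<close>.  Symmetric groups act on the left: on operations
  given by functions, $(\sigma \cdot a)(x_1, \dots, x_n) = a(x_{\sigma(1)}, \dots, x_{\sigma(n)})$.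
\<close>

record 'a operad =
  ops :: "nat \<Rightarrow> 'a set"
  unit_op :: 'a
  pcomp :: "nat \<Rightarrow> nat \<Rightarrow> nat \<Rightarrow> 'a \<Rightarrow> 'a \<Rightarrow> 'a"
  sact :: "nat \<Rightarrow> (nat \<Rightarrow> nat) \<Rightarrow> 'a \<Rightarrow> 'a"

text \<open>
  In $a \circ_i b$ with \<open>b\<close> of arity \<open>m\<close>, the inputs of \<open>b\<close> occupy the positions
  $i, \dots, i + m - 1$, and an input $p \neq i$ of \<open>a\<close> moves to \<open>outer_slot m i p\<close>.
  The permutation \<open>block_perm m i \<sigma> \<tau>\<close> is the one with
  $(\sigma \cdot a) \circ_{\sigma(i)} (\tau \cdot b) = \mathrm{block\_perm} \cdot (a \circ_i b)$.
\<close>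

definition outer_slot :: "nat \<Rightarrow> nat \<Rightarrow> nat \<Rightarrow> nat" where
  "outer_slot m i p = (if p < i then p else p + m - 1)"

definition block_perm ::
  "nat \<Rightarrow> nat \<Rightarrow> (nat \<Rightarrow> nat) \<Rightarrow> (nat \<Rightarrow> nat) \<Rightarrow> nat \<Rightarrow> nat" where
  "block_perm m i \<sigma> \<tau> p =
     (if p < i then outer_slot m (\<sigma> i) (\<sigma> p)
      else if p < i + m then \<sigma> i + \<tau> (p + 1 - i) - 1
      else outer_slot m (\<sigma> i) (\<sigma> (p + 1 - m)))"

text \<open>
  A structure with the operations of a symmetric operad, not yet subject to any equations.
\<close>

definition pre_operad :: "'a operad \<Rightarrow> bool" where
  "pre_operad P \<longleftrightarrow>
     unit_op P \<in> ops P 1 \<and>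
     (\<forall>n m i a b. a \<in> ops P n \<longrightarrow> b \<in> ops P m \<longrightarrow> i \<in> {1..n} \<longrightarrow>
        pcomp P n m i a b \<in> ops P (n + m - 1)) \<and>
     (\<forall>n \<sigma> a. a \<in> ops P n \<longrightarrow> \<sigma> permutes {1..n} \<longrightarrow> sact P n \<sigma> a \<in> ops P n)"

text \<open>
  \<open>operad_law P n a b\<close> says that $a = b$ is an instance, in arity \<open>n\<close>, of an axiom of
  symmetric operads.  The axioms are a predicate of their own because they are used twice: a set
  operad satisfies them, and the free operad is obtained by imposing them on formal terms.
\<close>

inductive operad_law :: "'a operad \<Rightarrow> nat \<Rightarrow> 'a \<Rightarrow> 'a \<Rightarrow> bool" for P where
  unit_left: "b \<in> ops P m \<Longrightarrow>
    operad_law P m (pcomp P 1 m 1 (unit_op P) b) b"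
| unit_right: "a \<in> ops P n \<Longrightarrow> i \<in> {1..n} \<Longrightarrow>
    operad_law P n (pcomp P n 1 i a (unit_op P)) a"
| sequential: "a \<in> ops P l \<Longrightarrow> b \<in> ops P m \<Longrightarrow> c \<in> ops P n \<Longrightarrow> i \<in> {1..l} \<Longrightarrow> j \<in> {1..m} \<Longrightarrow>
    operad_law P (l + m + n - 2)
      (pcomp P (l + m - 1) n (i + j - 1) (pcomp P l m i a b) c)
      (pcomp P l (m + n - 1) i a (pcomp P m n j b c))"
| parallel: "a \<in> ops P l \<Longrightarrow> b \<in> ops P m \<Longrightarrow> c \<in> ops P n \<Longrightarrow> i \<in> {1..l} \<Longrightarrow> k \<in> {1..l} \<Longrightarrow> i < k \<Longrightarrow>
    operad_law P (l + m + n - 2)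
      (pcomp P (l + m - 1) n (k + m - 1) (pcomp P l m i a b) c)
      (pcomp P (l + n - 1) m i (pcomp P l n k a c) b)"
| act_id: "a \<in> ops P n \<Longrightarrow>
    operad_law P n (sact P n id a) a"
| act_comp: "a \<in> ops P n \<Longrightarrow> \<sigma> permutes {1..n} \<Longrightarrow> \<tau> permutes {1..n} \<Longrightarrow>
    operad_law P n (sact P n (\<sigma> \<circ> \<tau>) a) (sact P n \<sigma> (sact P n \<tau> a))"
| equivariance: "a \<in> ops P n \<Longrightarrow> b \<in> ops P m \<Longrightarrow> i \<in> {1..n} \<Longrightarrow>
    \<sigma> permutes {1..n} \<Longrightarrow> \<tau> permutes {1..m} \<Longrightarrow>
    operad_law P (n + m - 1)
      (pcomp P n m (\<sigma> i) (sact P n \<sigma> a) (sact P m \<tau> b))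
      (sact P (n + m - 1) (block_perm m i \<sigma> \<tau>) (pcomp P n m i a b))"

definition set_operad :: "'a operad \<Rightarrow> bool" where
  "set_operad P \<longleftrightarrow> pre_operad P \<and> (\<forall>n a b. operad_law P n a b \<longrightarrow> a = b)"

definition operad_hom :: "'a operad \<Rightarrow> 'b operad \<Rightarrow> (nat \<Rightarrow> 'a \<Rightarrow> 'b) \<Rightarrow> bool" where
  "operad_hom P Q \<phi> \<longleftrightarrow>
     (\<forall>n a. a \<in> ops P n \<longrightarrow> \<phi> n a \<in> ops Q n) \<and>
     \<phi> 1 (unit_op P) = unit_op Q \<and>
     (\<forall>n m i a b. a \<in> ops P n \<longrightarrow> b \<in> ops P m \<longrightarrow> i \<in> {1..n} \<longrightarrow>
        \<phi> (n + m - 1) (pcomp P n m i a b) = pcomp Q n m i (\<phi> n a) (\<phi> m b)) \<and>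
     (\<forall>n \<sigma> a. a \<in> ops P n \<longrightarrow> \<sigma> permutes {1..n} \<longrightarrow>
        \<phi> n (sact P n \<sigma> a) = sact Q n \<sigma> (\<phi> n a))"

definition operad_iso :: "'a operad \<Rightarrow> 'b operad \<Rightarrow> (nat \<Rightarrow> 'a \<Rightarrow> 'b) \<Rightarrow> bool" where
  "operad_iso P Q \<phi> \<longleftrightarrow> operad_hom P Q \<phi> \<and> (\<forall>n. bij_betw (\<phi> n) (ops P n) (ops Q n))"

definition isomorphic_set_operads :: "'a operad \<Rightarrow> 'b operad \<Rightarrow> bool" where
  "isomorphic_set_operads P Q \<longleftrightarrow>
     set_operad P \<and> set_operad Q \<and> (\<exists>\<phi>. operad_iso P Q \<phi>)"


section \<open>The permutative operad and the operad of non-empty subsets\<close>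

definition perm_operad :: "nat operad" where
  "perm_operad =
     \<lparr> ops = (\<lambda>n. {1..n}),
       unit_op = 1,
       pcomp = (\<lambda>n m k i j. if k < i then i + m - 1 else if k = i then i + j - 1 else i),
       sact = (\<lambda>n \<sigma> i. \<sigma> i) \<rparr>"

definition subset_operad :: "'a operad \<Rightarrow> 'a set operad" where
  "subset_operad P =
     \<lparr> ops = (\<lambda>n. {A. A \<subseteq> ops P n \<and> A \<noteq> {}}),
       unit_op = {unit_op P},
       pcomp = (\<lambda>n m i A B. {pcomp P n m i a b | a b. a \<in> A \<and> b \<in> B}),
       sact = (\<lambda>n \<sigma> A. sact P n \<sigma> ` A) \<rparr>"


section \<open>Quotients by generated congruences\<close>

inductive gen_cong :: "'a operad \<Rightarrow> (nat \<Rightarrow> 'a \<Rightarrow> 'a \<Rightarrow> bool) \<Rightarrow> nat \<Rightarrow> 'a \<Rightarrow> 'a \<Rightarrow> bool"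
  for P S where
  base: "S n a b \<Longrightarrow> a \<in> ops P n \<Longrightarrow> b \<in> ops P n \<Longrightarrow> gen_cong P S n a b"
| refl: "a \<in> ops P n \<Longrightarrow> gen_cong P S n a a"
| sym: "gen_cong P S n a b \<Longrightarrow> gen_cong P S n b a"
| trans: "gen_cong P S n a b \<Longrightarrow> gen_cong P S n b c \<Longrightarrow> gen_cong P S n a c"
| pcomp: "gen_cong P S n a a' \<Longrightarrow> gen_cong P S m b b' \<Longrightarrow> i \<in> {1..n} \<Longrightarrow>
    gen_cong P S (n + m - 1) (pcomp P n m i a b) (pcomp P n m i a' b')"
| sact: "gen_cong P S n a a' \<Longrightarrow> \<sigma> permutes {1..n} \<Longrightarrow>
    gen_cong P S n (sact P n \<sigma> a) (sact P n \<sigma> a')"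

definition cong_rel :: "'a operad \<Rightarrow> (nat \<Rightarrow> 'a \<Rightarrow> 'a \<Rightarrow> bool) \<Rightarrow> nat \<Rightarrow> ('a \<times> 'a) set" where
  "cong_rel P S n = {(a, b). gen_cong P S n a b}"

definition quotient_operad ::
  "'a operad \<Rightarrow> (nat \<Rightarrow> 'a \<Rightarrow> 'a \<Rightarrow> bool) \<Rightarrow> 'a set operad" where
  "quotient_operad P S =
     \<lparr> ops = (\<lambda>n. ops P n // cong_rel P S n),
       unit_op = cong_rel P S 1 `` {unit_op P},
       pcomp = (\<lambda>n m i A B. \<Union>a\<in>A. \<Union>b\<in>B. cong_rel P S (n + m - 1) `` {pcomp P n m i a b}),
       sact = (\<lambda>n \<sigma> A. \<Union>a\<in>A. cong_rel P S n `` {sact P n \<sigma> a}) \<rparr>"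


section \<open>Free symmetric operads\<close>

text \<open>
  A family of sets of generators with actions of the symmetric groups.
\<close>

record 'g collection =
  gens :: "nat \<Rightarrow> 'g set"
  gact :: "nat \<Rightarrow> (nat \<Rightarrow> nat) \<Rightarrow> 'g \<Rightarrow> 'g"

datatype 'g opterm =
    Unit
  | Gen nat 'g
  | PComp nat nat nat "'g opterm" "'g opterm"
  | SAct nat "nat \<Rightarrow> nat" "'g opterm"

inductive opterm_of :: "'g collection \<Rightarrow> nat \<Rightarrow> 'g opterm \<Rightarrow> bool" for E where
  "opterm_of E 1 Unit"
| "g \<in> gens E n \<Longrightarrow> opterm_of E n (Gen n g)"
| "opterm_of E n s \<Longrightarrow> opterm_of E m t \<Longrightarrow> i \<in> {1..n} \<Longrightarrow>
    opterm_of E (n + m - 1) (PComp n m i s t)"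
| "opterm_of E n t \<Longrightarrow> \<sigma> permutes {1..n} \<Longrightarrow> opterm_of E n (SAct n \<sigma> t)"

definition term_operad :: "'g collection \<Rightarrow> 'g opterm operad" where
  "term_operad E =
     \<lparr> ops = (\<lambda>n. {t. opterm_of E n t}), unit_op = Unit, pcomp = PComp, sact = SAct \<rparr>"

text \<open>
  Formal terms in the generators, modulo the axioms of symmetric operads and the identification of
  the formal action on generators with the given one.  The universal property is
  \<open>free_operad_universal\<close> below.
\<close>

inductive free_law :: "'g collection \<Rightarrow> nat \<Rightarrow> 'g opterm \<Rightarrow> 'g opterm \<Rightarrow> bool" for E where
  "operad_law (term_operad E) n s t \<Longrightarrow> free_law E n s t"
| "g \<in> gens E n \<Longrightarrow> \<sigma> permutes {1..n} \<Longrightarrow>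
    free_law E n (SAct n \<sigma> (Gen n g)) (Gen n (gact E n \<sigma> g))"

definition free_operad :: "'g collection \<Rightarrow> 'g opterm set operad" where
  "free_operad E = quotient_operad (term_operad E) (free_law E)"

definition free_gen :: "'g collection \<Rightarrow> nat \<Rightarrow> 'g \<Rightarrow> 'g opterm set" where
  "free_gen E n g = cong_rel (term_operad E) (free_law E) n `` {Gen n g}"


section \<open>The commutative triassociative operad\<close>

datatype trias_gen = Dashv | Vdash | Perp

fun flip_gen :: "trias_gen \<Rightarrow> trias_gen" where
  "flip_gen Dashv = Vdash"
| "flip_gen Vdash = Dashv"
| "flip_gen Perp = Perp"

definition trias_collection :: "trias_gen collection" where
  "trias_collection =
     \<lparr> gens = (\<lambda>n. if n = 2 then {Dashv, Vdash, Perp} else {}),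
       gact = (\<lambda>n \<sigma> g. if \<sigma> = transpose 1 2 then flip_gen g else g) \<rparr>"

text \<open>\<open>trias_comp f i g\<close> is the ternary operation $f \circ_i g$ of the free operad.\<close>

definition trias_comp :: "trias_gen \<Rightarrow> nat \<Rightarrow> trias_gen \<Rightarrow> trias_gen opterm set" where
  "trias_comp f i g =
     pcomp (free_operad trias_collection) 2 2 i
       (free_gen trias_collection 2 f) (free_gen trias_collection 2 g)"

inductive trias_relation ::
  "nat \<Rightarrow> trias_gen opterm set \<Rightarrow> trias_gen opterm set \<Rightarrow> bool" where
  "trias_relation 3 (trias_comp Dashv 1 Dashv) (trias_comp Dashv 2 Dashv)"
| "trias_relation 3 (trias_comp Dashv 2 Dashv) (trias_comp Dashv 2 Vdash)"
| "trias_relation 3 (trias_comp Dashv 2 Vdash) (trias_comp Dashv 2 Perp)"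
| "trias_relation 3 (trias_comp Vdash 2 Vdash) (trias_comp Vdash 1 Dashv)"
| "trias_relation 3 (trias_comp Vdash 1 Dashv) (trias_comp Vdash 1 Vdash)"
| "trias_relation 3 (trias_comp Vdash 1 Vdash) (trias_comp Vdash 1 Perp)"
| "trias_relation 3 (trias_comp Dashv 1 Vdash) (trias_comp Vdash 2 Dashv)"
| "trias_relation 3 (trias_comp Perp 1 Dashv) (trias_comp Perp 2 Vdash)"
| "trias_relation 3 (trias_comp Perp 1 Vdash) (trias_comp Vdash 2 Perp)"
| "trias_relation 3 (trias_comp Dashv 1 Perp) (trias_comp Perp 2 Dashv)"
| "trias_relation 3 (trias_comp Perp 1 Perp) (trias_comp Perp 2 Perp)"

definition com_trias :: "trias_gen opterm set set operad" where
  "com_trias = quotient_operad (free_operad trias_collection) trias_relation"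


section \<open>Well-definedness\<close>

lemma pre_operadD:
  assumes "pre_operad P"
  shows "unit_op P \<in> ops P 1"
    and "a \<in> ops P n \<Longrightarrow> b \<in> ops P m \<Longrightarrow> i \<in> {1..n} \<Longrightarrow> pcomp P n m i a b \<in> ops P (n + m - 1)"
    and "a \<in> ops P n \<Longrightarrow> \<sigma> permutes {1..n} \<Longrightarrow> sact P n \<sigma> a \<in> ops P n"
  using assms unfolding pre_operad_def by auto

lemma block_perm_outer:
  assumes "p \<noteq> i" "p \<ge> 1" "i \<ge> 1"
  shows "block_perm m i \<sigma> \<tau> (outer_slot m i p) = outer_slot m (\<sigma> i) (\<sigma> p)"
proof (cases "p < i")
  case True
  then show ?thesis by (simp add: block_perm_def outer_slot_def)
next
  case False
  then have "\<not> p + m - 1 < i" "\<not> p + m - 1 < i + m" "p + m - 1 + 1 - m = p"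
    using assms by auto
  then show ?thesis using False by (simp only: block_perm_def outer_slot_def if_False)
qed

lemma block_perm_inner:
  assumes "q \<in> {1..m}"
  shows "block_perm m i \<sigma> \<tau> (i + q - 1) = \<sigma> i + \<tau> q - 1"
proof -
  have "\<not> i + q - 1 < i" "i + q - 1 < i + m" "i + q - 1 + 1 - i = q"
    using assms by auto
  then show ?thesis by (simp only: block_perm_def if_False if_True)
qed

lemma block_perm_permutes:
  assumes \<sigma>: "\<sigma> permutes {1..n}" and \<tau>: "\<tau> permutes {1..m}" and i: "i \<in> {1..n}"
  shows "block_perm m i \<sigma> \<tau> permutes {1..n + m - 1}"
proof -
  have s_in: "\<sigma> p \<in> {1..n}" if "p \<in> {1..n}" for p
    using permutes_in_image[OF \<sigma>] that by blast
  have t_in: "\<tau> p \<in> {1..m}" if "p \<in> {1..m}" for p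
    using permutes_in_image[OF \<tau>] that by blast
  have s_inj: "\<sigma> p = \<sigma> q \<longleftrightarrow> p = q" for p q
    using permutes_inj[OF \<sigma>] by (auto dest: injD)
  have t_inj: "\<tau> p = \<tau> q \<longleftrightarrow> p = q" for p q
    using permutes_inj[OF \<tau>] by (auto dest: injD)
  have s_out: "\<sigma> p = p" if "p \<notin> {1..n}" for p
    using \<sigma> that by (simp add: permutes_def)
  have si: "\<sigma> i \<in> {1..n}" using s_in i by blast
  have lo: "block_perm m i \<sigma> \<tau> p = outer_slot m (\<sigma> i) (\<sigma> p)" "\<sigma> p \<in> {1..n}" "\<sigma> p \<noteq> \<sigma> i"
    if "p \<in> {1..n + m - 1}" "p < i" for p
    using that i s_in[of p] s_inj by (auto simp: block_perm_def)
  have mid: "block_perm m i \<sigma> \<tau> p = \<sigma> i + \<tau> (p + 1 - i) - 1" "\<tau> (p + 1 - i) \<in> {1..m}"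
    if "p \<in> {1..n + m - 1}" "\<not> p < i" "p < i + m" for p
  proof -
    have "p + 1 - i \<in> {1..m}" using that by auto
    then show "block_perm m i \<sigma> \<tau> p = \<sigma> i + \<tau> (p + 1 - i) - 1" "\<tau> (p + 1 - i) \<in> {1..m}"
      using that t_in[of "p + 1 - i"] by (auto simp: block_perm_def)
  qed
  have hi: "block_perm m i \<sigma> \<tau> p = outer_slot m (\<sigma> i) (\<sigma> (p + 1 - m))"
      "\<sigma> (p + 1 - m) \<in> {1..n}" "\<sigma> (p + 1 - m) \<noteq> \<sigma> i"
    if "p \<in> {1..n + m - 1}" "\<not> p < i" "\<not> p < i + m" for p
  proof -
    have "p + 1 - m \<in> {1..n}" "p + 1 - m \<noteq> i" using that i by auto
    then show "block_perm m i \<sigma> \<tau> p = outer_slot m (\<sigma> i) (\<sigma> (p + 1 - m))"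
      "\<sigma> (p + 1 - m) \<in> {1..n}" "\<sigma> (p + 1 - m) \<noteq> \<sigma> i"
      using that s_in[of "p + 1 - m"] s_inj by (auto simp: block_perm_def)
  qed
  have slot_range: "outer_slot m (\<sigma> i) q \<in> {1..n + m - 1}"
      "outer_slot m (\<sigma> i) q < \<sigma> i \<or> outer_slot m (\<sigma> i) q \<ge> \<sigma> i + m"
    if "q \<in> {1..n}" "q \<noteq> \<sigma> i" for q
    using that si by (auto simp: outer_slot_def)
  have slot_inj: "outer_slot m (\<sigma> i) q = outer_slot m (\<sigma> i) r \<longleftrightarrow> q = r"
    if "q \<in> {1..n}" "q \<noteq> \<sigma> i" "r \<in> {1..n}" "r \<noteq> \<sigma> i" for q r
    using that si by (auto simp: outer_slot_def)
  have range: "block_perm m i \<sigma> \<tau> p \<in> {1..n + m - 1}" if p: "p \<in> {1..n + m - 1}" for p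
  proof -
    consider "p < i" | "\<not> p < i" "p < i + m" | "\<not> p < i" "\<not> p < i + m" by blast
    then show ?thesis
    proof cases
      case 1
      then show ?thesis using lo[OF p] slot_range by simp
    next
      case 2
      then show ?thesis using mid[OF p] si by auto
    next
      case 3
      then show ?thesis using hi[OF p] slot_range by simp
    qed
  qed
  have inj: "inj_on (block_perm m i \<sigma> \<tau>) {1..n + m - 1}"
  proof (rule linorder_inj_onI')
    fix p q assume p: "p \<in> {1..n + m - 1}" and q: "q \<in> {1..n + m - 1}" and pq: "p < q"
    consider "q < i" | "p < i" "\<not> q < i" "q < i + m" | "p < i" "\<not> q < i" "\<not> q < i + m"
      | "\<not> p < i" "p < i + m" "\<not> q < i" "q < i + m"
      | "\<not> p < i" "p < i + m" "\<not> q < i" "\<not> q < i + m"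
      | "\<not> p < i" "\<not> p < i + m" "\<not> q < i" "\<not> q < i + m"
      using pq by linarith
    then show "block_perm m i \<sigma> \<tau> p \<noteq> block_perm m i \<sigma> \<tau> q"
    proof cases
      case 1
      then show ?thesis using lo[OF p] lo[OF q] pq slot_inj s_inj by auto
    next
      case 2
      then show ?thesis using lo[OF p] mid[OF q] slot_range(2)[of "\<sigma> p"] by auto
    next
      case 3
      then have "q + 1 - m \<noteq> p" by auto
      then show ?thesis using 3 lo[OF p] hi[OF q] slot_inj s_inj by auto
    next
      case 4
      then have "\<tau> (q + 1 - i) \<noteq> \<tau> (p + 1 - i)" using t_inj pq by auto
      then show ?thesis
        using mid[OF p 4(1,2)] mid[OF q 4(3,4)] unfolding atLeastAtMost_iff by linarith
    next
      case 5
      then show ?thesis using mid[OF p 5(1,2)] hi[OF q 5(3,4)] slot_range(2)[of "\<sigma> (q + 1 - m)"]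
        unfolding atLeastAtMost_iff by linarith
    next
      case 6
      then have "q + 1 - m \<noteq> p + 1 - m" using pq by auto
      then show ?thesis using 6 hi[OF p] hi[OF q] slot_inj s_inj by auto
    qed
  qed
  have "bij_betw (block_perm m i \<sigma> \<tau>) {1..n + m - 1} {1..n + m - 1}"
    using range inj by (intro bij_betw_imageI endo_inj_surj) auto
  moreover have "block_perm m i \<sigma> \<tau> p = p" if "p \<notin> {1..n + m - 1}" for p
  proof (cases "p = 0")
    case True
    then show ?thesis using i si s_out[of 0] by (auto simp: block_perm_def outer_slot_def)
  next
    case False
    then have p: "p > n + m - 1" using that by auto
    then have "\<sigma> (p + 1 - m) = p + 1 - m" by (intro s_out) auto
    then show ?thesis using p i si by (auto simp: block_perm_def outer_slot_def)
  qed
  ultimately show ?thesis by (rule bij_imp_permutes)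
qed

lemma operad_law_closed:
  assumes P: "pre_operad P" and "operad_law P n a b"
  shows "a \<in> ops P n" "b \<in> ops P n"
proof -
  note cl = pre_operadD[OF P]
  have ar: "(l + m - 1) + n - 1 = l + m + n - 2" "l + (m + n - 1) - 1 = l + m + n - 2"
    if "l \<ge> 1" "m \<ge> 1" for l m n :: nat using that by auto
  have "a \<in> ops P n \<and> b \<in> ops P n"
    using assms(2)
  proof cases
    case (unit_left)
    then show ?thesis using cl(2)[OF cl(1), of b n 1] by simp
  next
    case (unit_right i)
    then show ?thesis using cl(2)[OF _ cl(1), of b n i] by simp
  next
    case (sequential a' l b' m c n' i j)
    have ij: "i + j - 1 \<in> {1..l + m - 1}" using sequential by auto
    have "l \<ge> 1" "m \<ge> 1" using sequential by auto
    note ar = ar[OF this, of n']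
    show ?thesis
      using cl(2)[OF cl(2)[OF \<open>a' \<in> ops P l\<close> \<open>b' \<in> ops P m\<close> \<open>i \<in> {1..l}\<close>] \<open>c \<in> ops P n'\<close> ij]
        cl(2)[OF \<open>a' \<in> ops P l\<close> cl(2)[OF \<open>b' \<in> ops P m\<close> \<open>c \<in> ops P n'\<close> \<open>j \<in> {1..m}\<close>] \<open>i \<in> {1..l}\<close>]
        sequential(1-3) ar by simp
  next
    case (parallel a' l b' m c n' i k)
    have ij: "k + m - 1 \<in> {1..l + m - 1}" "i \<in> {1..l + n' - 1}" using parallel by auto
    have ar: "(l + m - 1) + n' - 1 = l + m + n' - 2" "(l + n' - 1) + m - 1 = l + m + n' - 2"
      using parallel by auto
    show ?thesis
      using cl(2)[OF cl(2)[OF \<open>a' \<in> ops P l\<close> \<open>b' \<in> ops P m\<close> \<open>i \<in> {1..l}\<close>] \<open>c \<in> ops P n'\<close> ij(1)]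
        cl(2)[OF cl(2)[OF \<open>a' \<in> ops P l\<close> \<open>c \<in> ops P n'\<close> \<open>k \<in> {1..l}\<close>] \<open>b' \<in> ops P m\<close> ij(2)]
        parallel(1-3) ar by simp
  next
    case act_id
    then show ?thesis using cl(3)[of b n id] permutes_id[of "{1..n}"] by (simp add: id_def)
  next
    case (act_comp a' \<sigma> \<tau>)
    show ?thesis
      unfolding act_comp(1,2) by (intro conjI cl(3) permutes_compose act_comp(3-5))
  next
    case (equivariance a' n' b' m i \<sigma> \<tau>)
    note p = \<open>i \<in> {1..n'}\<close> \<open>\<sigma> permutes {1..n'}\<close> \<open>\<tau> permutes {1..m}\<close>
    have "\<sigma> i \<in> {1..n'}" using permutes_in_image[OF p(2)] p(1) by blast
    then show ?thesis
      unfolding equivariance(1-3)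
      by (intro conjI cl(2,3) block_perm_permutes p equivariance(4,5))
  qed
  then show "a \<in> ops P n" "b \<in> ops P n" by auto
qed

lemma set_operad_perm_operad: "set_operad perm_operad"
proof -
  have pre: "pre_operad perm_operad"
    unfolding pre_operad_def perm_operad_def
    by (auto simp: permutes_in_image simp del: atLeastAtMost_iff) auto
  have "a = b" if "operad_law perm_operad n a b" for n a b
    using that
  proof cases
    case (equivariance p n' q m i \<sigma> \<tau>)
    have s: "\<sigma> p = \<sigma> i \<longleftrightarrow> p = i"
      using permutes_inj[OF \<open>\<sigma> permutes {1..n'}\<close>] by (auto dest: injD)
    have "\<sigma> i \<in> {1..n'}" "\<sigma> p \<in> {1..n'}" "\<tau> q \<in> {1..m}"
      using permutes_in_image[OF equivariance(7)] permutes_in_image[OF equivariance(8)]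
        equivariance(4,5,6) by (simp_all add: perm_operad_def)
    moreover have "p \<ge> 1" "q \<ge> 1" "q \<le> m" "i \<ge> 1"
      using equivariance by (auto simp: perm_operad_def)
    moreover have "block_perm m i \<sigma> \<tau> (i + q - 1) = \<sigma> i + \<tau> q - 1"
      using block_perm_inner calculation by simp
    moreover have "block_perm m i \<sigma> \<tau> (outer_slot m i p) = outer_slot m (\<sigma> i) (\<sigma> p)" if "p \<noteq> i"
      using block_perm_outer calculation that by simp
    ultimately show ?thesis
      unfolding equivariance(2,3) perm_operad_def using s
      by (cases i p rule: linorder_cases; cases "\<sigma> i" "\<sigma> p" rule: linorder_cases)
        (simp_all add: outer_slot_def)
  next
    case (sequential p l q m r n' i j)
    then have "p \<ge> 1" "q \<ge> 1" "r \<ge> 1" "q \<le> m" "i \<ge> 1" "j \<ge> 1" "j \<le> m"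
      by (auto simp: perm_operad_def)
    then show ?thesis
      unfolding sequential(2,3) perm_operad_def
      by (cases i p rule: linorder_cases; cases j q rule: linorder_cases; simp; presburger?)
  next
    case (parallel p l q m r n' i k)
    then have "p \<ge> 1" "q \<ge> 1" "r \<ge> 1" "q \<le> m" "r \<le> n'" "i \<ge> 1" "i < k"
      by (auto simp: perm_operad_def)
    then show ?thesis
      unfolding parallel(2,3) perm_operad_def
      by (cases i p rule: linorder_cases; cases k p rule: linorder_cases; simp; presburger?)
  qed (auto simp: perm_operad_def)
  with pre show ?thesis unfolding set_operad_def by blast
qed

lemma set_operad_subset_operad:
  assumes "set_operad P"
  shows "set_operad (subset_operad P)"
proof -
  have P: "pre_operad P" and law: "\<And>n a b. operad_law P n a b \<Longrightarrow> a = b"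
    using assms unfolding set_operad_def by auto
  note cl = pre_operadD[OF P]
  have pre: "pre_operad (subset_operad P)"
    unfolding pre_operad_def subset_operad_def
    using cl by (auto simp: subset_iff)
  have comp: "pcomp (subset_operad P) n m i A B = (\<Union>a\<in>A. \<Union>b\<in>B. {pcomp P n m i a b})" for n m i A B
    by (auto simp: subset_operad_def)
  have act: "sact (subset_operad P) n \<sigma> A = (\<Union>a\<in>A. {sact P n \<sigma> a})" for n \<sigma> A
    by (auto simp: subset_operad_def)
  have unit: "unit_op (subset_operad P) = {unit_op P}"
    by (auto simp: subset_operad_def)
  have opsD: "a \<in> ops P n" if "A \<in> ops (subset_operad P) n" "a \<in> A" for A n a
    using that by (auto simp: subset_operad_def)
  have "A = B" if "operad_law (subset_operad P) n A B" for n A B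
    using that
  proof cases
    case unit_left
    then show ?thesis unfolding comp unit
      using law[OF operad_law.unit_left[OF opsD]] by force
  next
    case (unit_right i)
    then show ?thesis unfolding comp unit
      using law[OF operad_law.unit_right[OF opsD]] by force
  next
    case (sequential A' l B' m C n' i j)
    have *: "pcomp P (l + m - 1) n' (i + j - 1) (pcomp P l m i a b) c =
       pcomp P l (m + n' - 1) i a (pcomp P m n' j b c)" if "a \<in> A'" "b \<in> B'" "c \<in> C" for a b c
      using law[OF operad_law.sequential] opsD that sequential by blast
    show ?thesis unfolding sequential comp by (auto simp: * simp del: One_nat_def)
  next
    case (parallel A' l B' m C n' i k)
    have *: "pcomp P (l + m - 1) n' (k + m - 1) (pcomp P l m i a b) c =
       pcomp P (l + n' - 1) m i (pcomp P l n' k a c) b" if "a \<in> A'" "b \<in> B'" "c \<in> C" for a b c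
      using law[OF operad_law.parallel] opsD that parallel by blast
    show ?thesis unfolding parallel comp by (auto simp: * simp del: One_nat_def)
  next
    case act_id
    then show ?thesis unfolding act
      using law[OF operad_law.act_id[OF opsD]] by force
  next
    case (act_comp A' \<sigma> \<tau>)
    have *: "sact P n (\<sigma> \<circ> \<tau>) a = sact P n \<sigma> (sact P n \<tau> a)" if "a \<in> A'" for a
      using law[OF operad_law.act_comp] opsD that act_comp by blast
    show ?thesis unfolding act_comp act by (auto simp: * simp del: One_nat_def)
  next
    case (equivariance A' n' B' m i \<sigma> \<tau>)
    have *: "pcomp P n' m (\<sigma> i) (sact P n' \<sigma> a) (sact P m \<tau> b) =
       sact P (n' + m - 1) (block_perm m i \<sigma> \<tau>) (pcomp P n' m i a b)" if "a \<in> A'" "b \<in> B'" for a b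
      using law[OF operad_law.equivariance] opsD that equivariance by blast
    show ?thesis unfolding equivariance comp act by (auto simp: * simp del: One_nat_def)
  qed
  with pre show ?thesis unfolding set_operad_def by blast
qed

lemma gen_cong_closed:
  assumes "pre_operad P" "gen_cong P S n a b"
  shows "a \<in> ops P n" "b \<in> ops P n"
proof -
  have "a \<in> ops P n \<and> b \<in> ops P n"
    using assms(2)
    by induction (auto intro: pre_operadD[OF assms(1)] simp del: atLeastAtMost_iff One_nat_def)
  then show "a \<in> ops P n" "b \<in> ops P n" by auto
qed

lemma equiv_cong_rel: "pre_operad P \<Longrightarrow> equiv (ops P n) (cong_rel P S n)"
  unfolding cong_rel_def
  by (auto intro!: equivI refl_onI symI transI
      intro: gen_cong.refl gen_cong.sym gen_cong.trans dest: gen_cong_closed)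

lemma cong_rel_iff: "(a, b) \<in> cong_rel P S n \<longleftrightarrow> gen_cong P S n a b"
  by (simp add: cong_rel_def)

lemma cong_class_eq_iff:
  assumes "pre_operad P" "a \<in> ops P n" "b \<in> ops P n"
  shows "cong_rel P S n `` {a} = cong_rel P S n `` {b} \<longleftrightarrow> gen_cong P S n a b"
  using eq_equiv_class_iff[OF equiv_cong_rel[OF assms(1)] assms(2,3)] by (simp add: cong_rel_iff)

lemma quotient_operad_ops:
  "ops (quotient_operad P S) n = (\<lambda>a. cong_rel P S n `` {a}) ` ops P n"
  by (auto simp: quotient_operad_def quotient_def)

lemma quotient_operad_unit: "unit_op (quotient_operad P S) = cong_rel P S 1 `` {unit_op P}"
  by (simp add: quotient_operad_def)

lemma quotient_operad_pcomp:
  assumes P: "pre_operad P" and a: "a \<in> ops P n" and b: "b \<in> ops P m" and i: "i \<in> {1..n}"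
  shows "pcomp (quotient_operad P S) n m i (cong_rel P S n `` {a}) (cong_rel P S m `` {b}) =
    cong_rel P S (n + m - 1) `` {pcomp P n m i a b}"
proof -
  let ?A = "cong_rel P S n `` {a}" and ?B = "cong_rel P S m `` {b}"
    and ?f = "\<lambda>a b. cong_rel P S (n + m - 1) `` {pcomp P n m i a b}"
  have "cong_rel P S (n + m - 1) `` {pcomp P n m i a' b'} = cong_rel P S (n + m - 1) `` {pcomp P n m i a b}"
    if "gen_cong P S n a a'" "gen_cong P S m b b'" for a' b'
    using equiv_class_eq[OF equiv_cong_rel[OF P]] gen_cong.pcomp[OF that i]
    by (metis cong_rel_iff)
  then have "(\<Union>a'\<in>?A. \<Union>b'\<in>?B. ?f a' b') = (\<Union>a'\<in>?A. \<Union>b'\<in>?B. ?f a b)"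
    by (intro SUP_cong refl) (simp_all add: cong_rel_iff)
  also have "\<dots> = ?f a b"
  proof -
    have "a \<in> ?A" "b \<in> ?B" using a b by (simp_all add: cong_rel_iff gen_cong.refl)
    then have "?A \<noteq> {}" "?B \<noteq> {}" by auto
    then show ?thesis by (simp only: UN_constant if_False)
  qed
  finally show ?thesis unfolding quotient_operad_def by simp
qed

lemma quotient_operad_sact:
  assumes P: "pre_operad P" and a: "a \<in> ops P n" and s: "\<sigma> permutes {1..n}"
  shows "sact (quotient_operad P S) n \<sigma> (cong_rel P S n `` {a}) = cong_rel P S n `` {sact P n \<sigma> a}"
proof -
  let ?A = "cong_rel P S n `` {a}" and ?f = "\<lambda>a. cong_rel P S n `` {sact P n \<sigma> a}"
  have "cong_rel P S n `` {sact P n \<sigma> a'} = cong_rel P S n `` {sact P n \<sigma> a}"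
    if "gen_cong P S n a a'" for a'
    using equiv_class_eq[OF equiv_cong_rel[OF P]] gen_cong.sact[OF that s]
    by (metis cong_rel_iff)
  then have "(\<Union>a'\<in>?A. ?f a') = (\<Union>a'\<in>?A. ?f a)"
    by (intro SUP_cong refl) (simp_all add: cong_rel_iff)
  also have "\<dots> = ?f a"
  proof -
    have "a \<in> ?A" using a by (simp add: cong_rel_iff gen_cong.refl)
    then have "?A \<noteq> {}" by auto
    then show ?thesis by (simp only: UN_constant if_False)
  qed
  finally show ?thesis unfolding quotient_operad_def by simp
qed

lemma quotient_operad_classI: "a \<in> ops P n \<Longrightarrow> cong_rel P S n `` {a} \<in> ops (quotient_operad P S) n"
  by (simp add: quotient_operad_ops)

lemma quotient_operad_classE:
  assumes "A \<in> ops (quotient_operad P S) n"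
  obtains a where "a \<in> ops P n" "A = cong_rel P S n `` {a}"
  using assms by (auto simp: quotient_operad_ops)

lemma pre_operad_quotient_operad:
  assumes P: "pre_operad P"
  shows "pre_operad (quotient_operad P S)"
  unfolding pre_operad_def
proof (intro conjI allI impI)
  show "unit_op (quotient_operad P S) \<in> ops (quotient_operad P S) 1"
    unfolding quotient_operad_unit by (intro quotient_operad_classI pre_operadD[OF P])
next
  fix n m i A B
  assume "A \<in> ops (quotient_operad P S) n" "B \<in> ops (quotient_operad P S) m"
  then obtain a b where ab: "a \<in> ops P n" "A = cong_rel P S n `` {a}"
    "b \<in> ops P m" "B = cong_rel P S m `` {b}" by (metis quotient_operad_classE)
  assume i: "i \<in> {1..n}"
  show "pcomp (quotient_operad P S) n m i A B \<in> ops (quotient_operad P S) (n + m - 1)"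
    unfolding ab quotient_operad_pcomp[OF P ab(1,3) i]
    by (intro quotient_operad_classI pre_operadD[OF P] ab i)
next
  fix n \<sigma> A
  assume "A \<in> ops (quotient_operad P S) n"
  then obtain a where a: "a \<in> ops P n" "A = cong_rel P S n `` {a}" by (metis quotient_operad_classE)
  assume s: "\<sigma> permutes {1..n}"
  show "sact (quotient_operad P S) n \<sigma> A \<in> ops (quotient_operad P S) n"
    unfolding a quotient_operad_sact[OF P a(1) s]
    by (intro quotient_operad_classI pre_operadD[OF P] a s)
qed

lemma operad_hom_quotient_operad:
  assumes P: "pre_operad P"
  shows "operad_hom P (quotient_operad P S) (\<lambda>n a. cong_rel P S n `` {a})"
  unfolding operad_hom_def quotient_operad_unit
  using quotient_operad_classI quotient_operad_pcomp[OF P] quotient_operad_sact[OF P] by metis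

lemma operad_law_quotient_operad:
  assumes P: "pre_operad P" and law: "operad_law (quotient_operad P S) n A B"
  shows "\<exists>a b. operad_law P n a b \<and> A = cong_rel P S n `` {a} \<and> B = cong_rel P S n `` {b}"
proof -
  let ?Q = "quotient_operad P S" and ?c = "\<lambda>n a. cong_rel P S n `` {a}"
  note cl = pre_operadD[OF P]
  note simps = quotient_operad_unit quotient_operad_pcomp[OF P] quotient_operad_sact[OF P]
  have rep: "\<exists>a. a \<in> ops P n \<and> A = ?c n a" if "A \<in> ops ?Q n" for A n
    using that by (auto simp: quotient_operad_ops)
  show ?thesis using law
  proof cases
    case unit_left
    then obtain b where b: "b \<in> ops P n" "B = ?c n b" using rep by blast
    have "A = ?c n (pcomp P 1 n 1 (unit_op P) b)"
      using unit_left b simps(2)[OF cl(1) b(1), of 1 S] by (simp add: quotient_operad_unit)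
    then show ?thesis using b operad_law.unit_left[OF b(1)] by blast
  next
    case (unit_right i)
    then obtain b where b: "b \<in> ops P n" "B = ?c n b" using rep by blast
    have "A = ?c n (pcomp P n 1 i b (unit_op P))"
      using unit_right b simps(2)[OF b(1) cl(1), of i S] by (simp add: quotient_operad_unit)
    then show ?thesis using b operad_law.unit_right[OF b(1)] unit_right by blast
  next
    case (sequential A' l B' m C n' i j)
    then obtain a b c where r: "a \<in> ops P l" "A' = ?c l a" "b \<in> ops P m" "B' = ?c m b"
      "c \<in> ops P n'" "C = ?c n' c" using rep by metis
    have ij: "i + j - 1 \<in> {1..l + m - 1}" using sequential by auto
    have ar: "(l + m - 1) + n' - 1 = l + m + n' - 2" "l + (m + n' - 1) - 1 = l + m + n' - 2"
      using sequential by auto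
    note L = operad_law.sequential[OF r(1,3,5) \<open>i \<in> {1..l}\<close> \<open>j \<in> {1..m}\<close>]
    have 1: "A = ?c n (pcomp P (l + m - 1) n' (i + j - 1) (pcomp P l m i a b) c)"
      unfolding sequential r simps(2)[OF r(1,3) \<open>i \<in> {1..l}\<close>]
        simps(2)[OF cl(2)[OF r(1,3) \<open>i \<in> {1..l}\<close>] r(5) ij] ar ..
    have 2: "B = ?c n (pcomp P l (m + n' - 1) i a (pcomp P m n' j b c))"
      unfolding sequential r simps(2)[OF r(3,5) \<open>j \<in> {1..m}\<close>]
        simps(2)[OF r(1) cl(2)[OF r(3,5) \<open>j \<in> {1..m}\<close>] \<open>i \<in> {1..l}\<close>] ar ..
    show ?thesis using L 1 2 sequential(1) by blast
  next
    case (parallel A' l B' m C n' i k)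
    then obtain a b c where r: "a \<in> ops P l" "A' = ?c l a" "b \<in> ops P m" "B' = ?c m b"
      "c \<in> ops P n'" "C = ?c n' c" using rep by metis
    have ij: "k + m - 1 \<in> {1..l + m - 1}" "i \<in> {1..l + n' - 1}" using parallel by auto
    have ar: "(l + m - 1) + n' - 1 = l + m + n' - 2" "(l + n' - 1) + m - 1 = l + m + n' - 2"
      using parallel by auto
    note L = operad_law.parallel[OF r(1,3,5) \<open>i \<in> {1..l}\<close> \<open>k \<in> {1..l}\<close> \<open>i < k\<close>]
    have 1: "A = ?c n (pcomp P (l + m - 1) n' (k + m - 1) (pcomp P l m i a b) c)"
      unfolding parallel r simps(2)[OF r(1,3) \<open>i \<in> {1..l}\<close>]
        simps(2)[OF cl(2)[OF r(1,3) \<open>i \<in> {1..l}\<close>] r(5) ij(1)] ar ..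
    have 2: "B = ?c n (pcomp P (l + n' - 1) m i (pcomp P l n' k a c) b)"
      unfolding parallel r simps(2)[OF r(1,5) \<open>k \<in> {1..l}\<close>]
        simps(2)[OF cl(2)[OF r(1,5) \<open>k \<in> {1..l}\<close>] r(3) ij(2)] ar ..
    show ?thesis using L 1 2 parallel(1) by blast
  next
    case act_id
    then obtain b where b: "b \<in> ops P n" "B = ?c n b" using rep by blast
    have "A = ?c n (sact P n id b)"
      using act_id b simps(3)[OF b(1) permutes_id, of S] by (simp add: id_def)
    then show ?thesis using b operad_law.act_id[OF b(1)] by blast
  next
    case (act_comp A' \<sigma> \<tau>)
    then obtain a where a: "a \<in> ops P n" "A' = ?c n a" using rep by blast
    have 1: "A = ?c n (sact P n (\<sigma> \<circ> \<tau>) a)"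
      unfolding act_comp(1) a(2)
      using simps(3)[OF a(1)] permutes_compose[OF act_comp(5,4)] by blast
    have 2: "B = ?c n (sact P n \<sigma> (sact P n \<tau> a))"
      unfolding act_comp(2) a(2)
      using simps(3)[OF a(1) act_comp(5)] simps(3)[OF cl(3)[OF a(1) act_comp(5)] act_comp(4)] by simp
    show ?thesis using 1 2 operad_law.act_comp[OF a(1) act_comp(4,5)] by blast
  next
    case (equivariance A' n' B' m i \<sigma> \<tau>)
    then obtain a b where r: "a \<in> ops P n'" "A' = ?c n' a" "b \<in> ops P m" "B' = ?c m b"
      using rep by metis
    note p = \<open>i \<in> {1..n'}\<close> \<open>\<sigma> permutes {1..n'}\<close> \<open>\<tau> permutes {1..m}\<close>
    have si: "\<sigma> i \<in> {1..n'}" using permutes_in_image[OF p(2)] p(1) by blast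
    have 1: "A = ?c n (pcomp P n' m (\<sigma> i) (sact P n' \<sigma> a) (sact P m \<tau> b))"
      unfolding equivariance r simps(3)[OF r(1) p(2)] simps(3)[OF r(3) p(3)]
        simps(2)[OF cl(3)[OF r(1) p(2)] cl(3)[OF r(3) p(3)] si] ..
    have 2: "B = ?c n (sact P (n' + m - 1) (block_perm m i \<sigma> \<tau>) (pcomp P n' m i a b))"
      unfolding equivariance r simps(2)[OF r(1,3) p(1)]
        simps(3)[OF cl(2)[OF r(1,3) p(1)] block_perm_permutes[OF p(2,3,1)]] ..
    show ?thesis
      using 1 2 operad_law.equivariance[OF r(1,3) p] equivariance(1) by blast
  qed
qed

lemma set_operad_quotient_operad:
  assumes "set_operad P"
  shows "set_operad (quotient_operad P S)"
proof -
  have P: "pre_operad P" and law: "\<And>n a b. operad_law P n a b \<Longrightarrow> a = b"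
    using assms unfolding set_operad_def by auto
  have "A = B" if "operad_law (quotient_operad P S) n A B" for n A B
    using operad_law_quotient_operad[OF P that] law by metis
  then show ?thesis
    unfolding set_operad_def using pre_operad_quotient_operad[OF P] by simp
qed

lemma pre_operad_term_operad: "pre_operad (term_operad E)"
  unfolding pre_operad_def term_operad_def
  by (auto simp del: atLeastAtMost_iff One_nat_def intro: opterm_of.intros)

lemma set_operad_free_operad: "set_operad (free_operad E)"
  unfolding set_operad_def free_operad_def
proof (intro conjI allI impI)
  show "pre_operad (quotient_operad (term_operad E) (free_law E))"
    by (rule pre_operad_quotient_operad[OF pre_operad_term_operad])
next
  fix n A B assume "operad_law (quotient_operad (term_operad E) (free_law E)) n A B"
  from operad_law_quotient_operad[OF pre_operad_term_operad this]
  obtain a b where ab: "operad_law (term_operad E) n a b"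
    "A = cong_rel (term_operad E) (free_law E) n `` {a}"
    "B = cong_rel (term_operad E) (free_law E) n `` {b}" by blast
  note closed = operad_law_closed[OF pre_operad_term_operad ab(1)]
  have "gen_cong (term_operad E) (free_law E) n a b"
    using closed ab(1) by (intro gen_cong.base free_law.intros(1))
  then show "A = B"
    using cong_class_eq_iff[OF pre_operad_term_operad closed] ab by blast
qed

lemma set_operad_com_trias: "set_operad com_trias"
  unfolding com_trias_def by (intro set_operad_quotient_operad set_operad_free_operad)

lemma free_gen_in_ops: "g \<in> gens E n \<Longrightarrow> free_gen E n g \<in> ops (free_operad E) n"
  unfolding free_gen_def free_operad_def quotient_operad_ops
  by (auto simp: term_operad_def intro: opterm_of.intros)

lemma trias_comp_in_ops:
  "i \<in> {1, 2} \<Longrightarrow> trias_comp f i g \<in> ops (free_operad trias_collection) 3"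
proof -
  assume i: "i \<in> {1, 2}"
  have "free_gen trias_collection 2 h \<in> ops (free_operad trias_collection) 2" for h
    by (rule free_gen_in_ops) (cases h; simp add: trias_collection_def)
  then have "trias_comp f i g \<in> ops (free_operad trias_collection) (2 + 2 - 1)"
    unfolding trias_comp_def
    using set_operad_free_operad[of trias_collection] i
    by (intro pre_operadD(2)) (auto simp: set_operad_def)
  then show ?thesis by simp
qed

lemma trias_relation_imp_cong:
  assumes "trias_relation n a b"
  shows "gen_cong (free_operad trias_collection) trias_relation n a b"
proof -
  have "n = 3 \<and> a \<in> ops (free_operad trias_collection) 3 \<and> b \<in> ops (free_operad trias_collection) 3"
    using assms by cases (auto intro: trias_comp_in_ops)
  then show ?thesis using assms by (intro gen_cong.base) auto
qed


section \<open>Universal properties\<close>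

lemma free_gen_equivariant:
  assumes g: "g \<in> gens E n" and s: "\<sigma> permutes {1..n}" and "gact E n \<sigma> g \<in> gens E n"
  shows "sact (free_operad E) n \<sigma> (free_gen E n g) = free_gen E n (gact E n \<sigma> g)"
proof -
  note T = pre_operad_term_operad[of E]
  have G: "Gen n h \<in> ops (term_operad E) n" if "h \<in> gens E n" for h
    using that by (auto simp: term_operad_def intro: opterm_of.intros)
  have A: "SAct n \<sigma> (Gen n g) \<in> ops (term_operad E) n"
    using g s by (auto simp: term_operad_def intro: opterm_of.intros)
  have "gen_cong (term_operad E) (free_law E) n (SAct n \<sigma> (Gen n g)) (Gen n (gact E n \<sigma> g))"
    by (rule gen_cong.base[OF _ A G[OF assms(3)]]) (rule free_law.intros(2)[OF g s])
  then have "cong_rel (term_operad E) (free_law E) n `` {sact (term_operad E) n \<sigma> (Gen n g)} =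
      cong_rel (term_operad E) (free_law E) n `` {Gen n (gact E n \<sigma> g)}"
    using cong_class_eq_iff[OF T A G[OF assms(3)]] by (simp add: term_operad_def)
  then show ?thesis
    unfolding free_operad_def free_gen_def quotient_operad_sact[OF T G[OF g] s] .
qed

lemma gen_cong_imp_eq:
  assumes P: "pre_operad P" and hom: "operad_hom P Q \<phi>"
    and S: "\<And>n a b. S n a b \<Longrightarrow> a \<in> ops P n \<Longrightarrow> b \<in> ops P n \<Longrightarrow> \<phi> n a = \<phi> n b"
    and ab: "gen_cong P S n a b"
  shows "\<phi> n a = \<phi> n b"
  using ab
proof induction
  case (pcomp n a a' m b b' i)
  then show ?case
    using hom gen_cong_closed[OF P pcomp(1)] gen_cong_closed[OF P pcomp(2)]
    unfolding operad_hom_def by metis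
next
  case (sact n a a' \<sigma>)
  then show ?case
    using hom gen_cong_closed[OF P sact(1)] unfolding operad_hom_def by metis
qed (auto intro: S)

lemma quotient_operad_universal:
  assumes P: "pre_operad P" and hom: "operad_hom P Q \<phi>"
    and S: "\<And>n a b. S n a b \<Longrightarrow> a \<in> ops P n \<Longrightarrow> b \<in> ops P n \<Longrightarrow> \<phi> n a = \<phi> n b"
  shows "\<exists>\<psi>. operad_hom (quotient_operad P S) Q \<psi> \<and>
    (\<forall>n. \<forall>a\<in>ops P n. \<psi> n (cong_rel P S n `` {a}) = \<phi> n a)"
proof -
  define \<psi> where "\<psi> n A = \<phi> n (SOME a. a \<in> A)" for n A
  have eq: "\<psi> n (cong_rel P S n `` {a}) = \<phi> n a" if "a \<in> ops P n" for n a
  proof -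
    have "a \<in> cong_rel P S n `` {a}" using that by (auto simp: cong_rel_iff intro: gen_cong.refl)
    then have "(SOME x. x \<in> cong_rel P S n `` {a}) \<in> cong_rel P S n `` {a}" by (rule someI)
    then have "gen_cong P S n a (SOME x. x \<in> cong_rel P S n `` {a})" by (simp add: cong_rel_iff)
    then show ?thesis unfolding \<psi>_def using gen_cong_imp_eq[OF P hom S] by metis
  qed
  have "operad_hom (quotient_operad P S) Q \<psi>"
    unfolding operad_hom_def
  proof (intro conjI allI impI)
    fix n A assume "A \<in> ops (quotient_operad P S) n"
    then show "\<psi> n A \<in> ops Q n"
      using hom eq unfolding operad_hom_def by (metis quotient_operad_classE)
  next
    show "\<psi> 1 (unit_op (quotient_operad P S)) = unit_op Q"
      using hom eq[OF pre_operadD(1)[OF P]] unfolding operad_hom_def quotient_operad_unit by simp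
  next
    fix n m i A B
    assume "A \<in> ops (quotient_operad P S) n" "B \<in> ops (quotient_operad P S) m"
    then obtain a b where ab: "a \<in> ops P n" "A = cong_rel P S n `` {a}"
      "b \<in> ops P m" "B = cong_rel P S m `` {b}" by (metis quotient_operad_classE)
    assume i: "i \<in> {1..n}"
    show "\<psi> (n + m - 1) (pcomp (quotient_operad P S) n m i A B) = pcomp Q n m i (\<psi> n A) (\<psi> m B)"
      unfolding ab quotient_operad_pcomp[OF P ab(1,3) i] eq[OF ab(1)] eq[OF ab(3)]
        eq[OF pre_operadD(2)[OF P ab(1,3) i]]
      using hom ab i unfolding operad_hom_def by blast
  next
    fix n \<sigma> A
    assume "A \<in> ops (quotient_operad P S) n"
    then obtain a where a: "a \<in> ops P n" "A = cong_rel P S n `` {a}"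
      by (metis quotient_operad_classE)
    assume s: "\<sigma> permutes {1..n}"
    show "\<psi> n (sact (quotient_operad P S) n \<sigma> A) = sact Q n \<sigma> (\<psi> n A)"
      unfolding a quotient_operad_sact[OF P a(1) s] eq[OF a(1)] eq[OF pre_operadD(3)[OF P a(1) s]]
      using hom a s unfolding operad_hom_def by blast
  qed
  then show ?thesis using eq by blast
qed

primrec opterm_eval :: "'a operad \<Rightarrow> (nat \<Rightarrow> 'g \<Rightarrow> 'a) \<Rightarrow> 'g opterm \<Rightarrow> 'a" where
  "opterm_eval P f Unit = unit_op P"
| "opterm_eval P f (Gen n g) = f n g"
| "opterm_eval P f (PComp n m i s t) = pcomp P n m i (opterm_eval P f s) (opterm_eval P f t)"
| "opterm_eval P f (SAct n \<sigma> t) = sact P n \<sigma> (opterm_eval P f t)"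

lemma opterm_eval_closed:
  assumes P: "pre_operad P" and f: "\<And>n g. g \<in> gens E n \<Longrightarrow> f n g \<in> ops P n"
    and t: "opterm_of E n t"
  shows "opterm_eval P f t \<in> ops P n"
  using t
proof induction
  case 1
  show ?case using pre_operadD(1)[OF P] by simp
next
  case (2 g n)
  then show ?case by (simp add: f)
next
  case (3 n s m t i)
  then show ?case by (simp add: pre_operadD(2)[OF P] del: atLeastAtMost_iff One_nat_def)
next
  case (4 n t \<sigma>)
  then show ?case by (simp add: pre_operadD(3)[OF P])
qed

theorem free_operad_universal:
  assumes P: "set_operad P"
    and f: "\<And>n g. g \<in> gens E n \<Longrightarrow> f n g \<in> ops P n"
    and f_act: "\<And>n g \<sigma>. g \<in> gens E n \<Longrightarrow> \<sigma> permutes {1..n} \<Longrightarrow> f n (gact E n \<sigma> g) = sact P n \<sigma> (f n g)"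
  shows "\<exists>\<phi>. operad_hom (free_operad E) P \<phi> \<and>
    (\<forall>n. \<forall>g\<in>gens E n. \<phi> n (free_gen E n g) = f n g)"
proof -
  have pre: "pre_operad P" and law: "\<And>n a b. operad_law P n a b \<Longrightarrow> a = b"
    using P unfolding set_operad_def by auto
  note T = pre_operad_term_operad[of E]
  let ?e = "opterm_eval P f"
  have cl: "?e t \<in> ops P n" if "t \<in> ops (term_operad E) n" for n t
    using opterm_eval_closed[OF pre f] that by (simp add: term_operad_def)
  have hom: "operad_hom (term_operad E) P (\<lambda>n. ?e)"
    unfolding operad_hom_def using cl by (auto simp: term_operad_def)
  have ev: "?e (unit_op (term_operad E)) = unit_op P"
    "?e (pcomp (term_operad E) n m i s t) = pcomp P n m i (?e s) (?e t)"
    "?e (sact (term_operad E) n \<sigma> t) = sact P n \<sigma> (?e t)" for n m i s t \<sigma>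
    by (auto simp: term_operad_def)
  have law_eq: "?e s = ?e t" if "free_law E n s t" for n s t
    using that
  proof cases
    case 1
    then have "operad_law P n (?e s) (?e t)"
    proof cases
      case (sequential a l b m c n i j)
      show ?thesis unfolding sequential ev by (intro operad_law.sequential cl sequential)
    next
      case (parallel a l b m c n i k)
      show ?thesis unfolding parallel ev by (intro operad_law.parallel cl parallel)
    next
      case (equivariance a n b m i \<sigma> \<tau>)
      show ?thesis unfolding equivariance ev by (intro operad_law.equivariance cl equivariance)
    qed (simp_all only: ev, (intro operad_law.intros cl; assumption)+)
    then show ?thesis by (rule law)
  next
    case (2 g \<sigma>)
    then show ?thesis by (simp add: f_act)
  qed
  have "\<exists>\<psi>. operad_hom (free_operad E) P \<psi> \<and>
    (\<forall>n. \<forall>t\<in>ops (term_operad E) n. \<psi> n (cong_rel (term_operad E) (free_law E) n `` {t}) = ?e t)"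
    unfolding free_operad_def by (rule quotient_operad_universal[OF T hom]) (rule law_eq)
  then obtain \<psi> where psi: "operad_hom (free_operad E) P \<psi>"
    "\<And>n t. t \<in> ops (term_operad E) n \<Longrightarrow> \<psi> n (cong_rel (term_operad E) (free_law E) n `` {t}) = ?e t"
    by blast
  have "\<psi> n (free_gen E n g) = f n g" if "g \<in> gens E n" for n g
    using psi(2)[of "Gen n g" n] that
    by (auto simp: free_gen_def term_operad_def intro: opterm_of.intros)
  with psi(1) show ?thesis by blast
qed

theorem free_operad_hom_unique:
  assumes "operad_hom (free_operad E) P \<phi>" "operad_hom (free_operad E) P \<psi>"
    and gen: "\<And>n g. g \<in> gens E n \<Longrightarrow> \<phi> n (free_gen E n g) = \<psi> n (free_gen E n g)"
    and "a \<in> ops (free_operad E) n"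
  shows "\<phi> n a = \<psi> n a"
proof -
  note T = pre_operad_term_operad[of E]
  let ?c = "\<lambda>n t. cong_rel (term_operad E) (free_law E) n `` {t}"
  have F: "pre_operad (free_operad E)" using set_operad_free_operad[of E] by (simp add: set_operad_def)
  have inF: "?c n t \<in> ops (free_operad E) n" if "opterm_of E n t" for n t
    using that by (simp add: free_operad_def quotient_operad_ops term_operad_def)
  have "\<phi> n (?c n t) = \<psi> n (?c n t)" if "opterm_of E n t" for t n
    using that
  proof induction
    case 1
    have "?c 1 Unit = unit_op (free_operad E)"
      by (simp add: free_operad_def quotient_operad_unit term_operad_def)
    then show ?case using assms(1,2) unfolding operad_hom_def by metis
  next
    case (2 g n)
    then show ?case using gen by (simp add: free_gen_def)
  next
    case (3 n s m t i)
    have "?c (n + m - 1) (PComp n m i s t) = pcomp (free_operad E) n m i (?c n s) (?c m t)"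
      using quotient_operad_pcomp[OF T, of s n t m i "free_law E"] 3
      by (simp add: free_operad_def term_operad_def)
    then show ?case using 3 inF assms(1,2) unfolding operad_hom_def by metis
  next
    case (4 n t \<sigma>)
    have "?c n (SAct n \<sigma> t) = sact (free_operad E) n \<sigma> (?c n t)"
      using quotient_operad_sact[OF T, of t n \<sigma> "free_law E"] 4
      by (simp add: free_operad_def term_operad_def)
    then show ?case using 4 inF assms(1,2) unfolding operad_hom_def by metis
  qed
  then show ?thesis
    using assms(4) by (auto simp: free_operad_def quotient_operad_ops term_operad_def)
qed

end

theory Submission
  imports Defs
begin

text \<open>
  Sending $\dashv, \vdash, \perp$ to $\{1\}, \{2\}, \{1,2\}$ respects the relations, so the
  universal properties of free operads and of quotients give a morphism $\varphi$ from
  \<open>com_trias\<close> to the subset operad (\<open>com_trias_hom_exists\<close>).  It is bijective because every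
  operation of \<open>com_trias\<close> can be brought to a normal form which its image under $\varphi$
  determines.

  Read $x \dashv y$ as a product $x y$.  As $\vdash$ is its opposite, the relations say that
  $\perp$ is commutative and associative, that
  $x (y z) = x (z y) = x (y \perp z) = (x y) z$, so that a second factor can be replaced by the
  inputs it contains, in any order, and that $x \perp (y z) = (x \perp y) z$.  Hence every operation with inputs $x_1, \dots, x_n$ is
  of the form
  \[ (x_{i_0} \perp \dots \perp x_{i_k})\, x_{j_1} \cdots x_{j_l}, \qquad k + 1 + l = n, \]
  where neither the order of the $i$'s nor that of the $j$'s matters, and its image is the
  subset $\{i_0, \dots, i_k\}$ of $[n]$.  Operadically, put
  $s_{k,l} = (x_1 \perp \dots \perp x_{k+1})\, x_{k+2} \cdots x_{k+1+l}$
  (\<open>std k l\<close>).  Two facts carry the proof.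

  \<^item> Existence of the normal form: the translates $\sigma \cdot s_{k,l}$ contain the unit and
    the generators and are closed under partial composition (\<open>normal_comp\<close>).  By equivariance only
    $s_{k,l} \circ_i s_{k',l'}$ has to be treated (\<open>std_comp_std\<close>).

  \<^item> Uniqueness: $s_{k,l}$ is fixed by the stabiliser of $\{1, \dots, k+1\}$
    (\<open>sact_stabilizer\<close>), so $\sigma \cdot s_{k,l}$ depends only on $k$, $l$ and the set
    $\sigma\{1, \dots, k+1\}$, which is $\varphi(\sigma \cdot s_{k,l})$.

  As every non-empty subset of $[n]$ is some $\sigma\{1, \dots, k+1\}$, the
  morphism is also surjective.
\<close>


section \<open>Morphisms and induction\<close>

lemma operad_homD:
  assumes "operad_hom P Q \<phi>"
  shows "a \<in> ops P n \<Longrightarrow> \<phi> n a \<in> ops Q n"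
    and "\<phi> 1 (unit_op P) = unit_op Q"
    and "a \<in> ops P n \<Longrightarrow> b \<in> ops P m \<Longrightarrow> i \<in> {1..n} \<Longrightarrow>
      \<phi> (n + m - 1) (pcomp P n m i a b) = pcomp Q n m i (\<phi> n a) (\<phi> m b)"
    and "a \<in> ops P n \<Longrightarrow> \<sigma> permutes {1..n} \<Longrightarrow> \<phi> n (sact P n \<sigma> a) = sact Q n \<sigma> (\<phi> n a)"
  using assms unfolding operad_hom_def by blast+

lemma operad_iso_inverse:
  assumes P: "pre_operad P" and iso: "operad_iso P Q \<phi>"
  shows "operad_iso Q P (\<lambda>n. inv_into (ops P n) (\<phi> n))"
proof -
  let ?\<psi> = "\<lambda>n. inv_into (ops P n) (\<phi> n)"
  note cl = pre_operadD[OF P]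
  have bij: "bij_betw (\<phi> n) (ops P n) (ops Q n)" and hom: "operad_hom P Q \<phi>" for n
    using iso by (auto simp: operad_iso_def)
  have bij': "bij_betw (?\<psi> n) (ops Q n) (ops P n)" for n using bij_betw_inv_into[OF bij] .
  have \<psi>: "?\<psi> n b \<in> ops P n" "\<phi> n (?\<psi> n b) = b" if "b \<in> ops Q n" for n b
    using that bij_betwE[OF bij'] bij_betw_inv_into_right[OF bij] by auto
  have eq: "?\<psi> n b = a" if "a \<in> ops P n" "b = \<phi> n a" for n a b
    using that bij_betw_inv_into_left[OF bij] by auto
  have "operad_hom Q P ?\<psi>"
    unfolding operad_hom_def
  proof (intro conjI allI impI)
    show "?\<psi> n b \<in> ops P n" if "b \<in> ops Q n" for n b using \<psi> that by blast
    show "?\<psi> 1 (unit_op Q) = unit_op P"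
      using hom by (intro eq cl) (simp add: operad_hom_def)
    show "?\<psi> (n + m - 1) (pcomp Q n m i a b) = pcomp P n m i (?\<psi> n a) (?\<psi> m b)"
      if "a \<in> ops Q n" "b \<in> ops Q m" "i \<in> {1..n}" for n m i a b
      using hom \<psi> that by (intro eq cl) (simp_all add: operad_hom_def)
    show "?\<psi> n (sact Q n \<sigma> a) = sact P n \<sigma> (?\<psi> n a)"
      if "a \<in> ops Q n" "\<sigma> permutes {1..n}" for n \<sigma> a
      using hom \<psi> that by (intro eq cl) (simp_all add: operad_hom_def)
  qed
  then show ?thesis using bij' by (simp add: operad_iso_def)
qed

text \<open>
  The free operad consists of classes of formal terms, so it is generated by its generators.
\<close>

lemma free_operad_induct [consumes 1, case_names unit gen comp act]:
  assumes "a \<in> ops (free_operad E) n"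
    and "R 1 (unit_op (free_operad E))"
    and "\<And>n g. g \<in> gens E n \<Longrightarrow> R n (free_gen E n g)"
    and "\<And>n m i a b. a \<in> ops (free_operad E) n \<Longrightarrow> b \<in> ops (free_operad E) m \<Longrightarrow> i \<in> {1..n} \<Longrightarrow>
      R n a \<Longrightarrow> R m b \<Longrightarrow> R (n + m - 1) (pcomp (free_operad E) n m i a b)"
    and "\<And>n \<sigma> a. a \<in> ops (free_operad E) n \<Longrightarrow> \<sigma> permutes {1..n} \<Longrightarrow> R n a \<Longrightarrow>
      R n (sact (free_operad E) n \<sigma> a)"
  shows "R n a"
proof -
  note T = pre_operad_term_operad[of E]
  let ?c = "\<lambda>n t. cong_rel (term_operad E) (free_law E) n `` {t}"
  have inF: "?c n t \<in> ops (free_operad E) n" if "opterm_of E n t" for n t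
    using that by (simp add: free_operad_def quotient_operad_ops term_operad_def)
  have "R n (?c n t)" if "opterm_of E n t" for t n
    using that
  proof induction
    case 1
    have "?c 1 Unit = unit_op (free_operad E)"
      by (simp add: free_operad_def quotient_operad_unit term_operad_def)
    then show ?case using assms(2) by metis
  next
    case (2 g n)
    then show ?case using assms(3) by (simp add: free_gen_def)
  next
    case (3 n s m t i)
    have "?c (n + m - 1) (PComp n m i s t) = pcomp (free_operad E) n m i (?c n s) (?c m t)"
      using quotient_operad_pcomp[OF T, of s n t m i "free_law E"] 3
      by (simp add: free_operad_def term_operad_def)
    then show ?case using assms(4)[OF inF[OF 3(1)] inF[OF 3(2)] 3(3) 3(4,5)] by metis
  next
    case (4 n t \<sigma>)
    have "?c n (SAct n \<sigma> t) = sact (free_operad E) n \<sigma> (?c n t)"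
      using quotient_operad_sact[OF T, of t n \<sigma> "free_law E"] 4
      by (simp add: free_operad_def term_operad_def)
    then show ?case using assms(5)[OF inF[OF 4(1)] 4(2,3)] by metis
  qed
  then show ?thesis
    using assms(1) by (auto simp: free_operad_def quotient_operad_ops term_operad_def)
qed


section \<open>Auxiliary permutations and compositions of subsets\<close>

lemma subset_perm_comp:
  "pcomp (subset_operad perm_operad) n m i A B =
   (\<Union>a\<in>A. \<Union>b\<in>B. {if i < a then a + m - 1 else if i = a then a + b - 1 else a})"
  unfolding subset_operad_def perm_operad_def operad.simps by blast

lemma restriction_permutes:
  assumes "bij_betw f A A"
  shows "(\<lambda>x. if x \<in> A then f x else x) permutes A"
  by (rule bij_imp_permutes, subst bij_betw_cong[of A _ f]) (simp_all add: assms)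

lemma block_perm_first_input:
  assumes "\<tau> permutes {1..m}"
  shows "block_perm m 1 id \<tau> = \<tau>"
proof
  fix p
  show "block_perm m 1 id \<tau> p = \<tau> p"
  proof (cases "p \<in> {1..m}")
    case True
    then show ?thesis by (simp add: block_perm_def)
  next
    case False
    then have "\<tau> p = p" using assms by (simp add: permutes_def)
    then show ?thesis using False by (auto simp: block_perm_def outer_slot_def)
  qed
qed

lemma block_perm_swap_later_inputs: "block_perm m 1 (transpose 2 3) id = transpose (Suc m) (Suc (Suc m))"
proof
  fix p
  consider "p \<le> m" | "p = Suc m" | "p = Suc (Suc m)" | "p > Suc (Suc m)" by linarith
  then show "block_perm m 1 (transpose 2 3) id p = transpose (Suc m) (Suc (Suc m)) p"
    by cases (auto simp: block_perm_def outer_slot_def transpose_def)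
qed


section \<open>Operations of arity two satisfying the relations\<close>

text \<open>
  The elements \<open>D\<close> and \<open>P\<close> of an arbitrary symmetric operad stand for $\dashv$ and $\perp$, and
  the operation $\vdash$ is the opposite of \<open>D\<close>.  In an algebra, with $x \dashv y$ written $x y$,
  the last five equations are
  $x (y z) = (x y) z$, $x (z y) = (x y) z$, $x (y \perp z) = (x y) z$,
  $x \perp (y z) = (x \perp y) z$ and $x \perp (y \perp z) = (x \perp y) \perp z$: each moves
  an operation from the second argument to the first.
\<close>

locale perm_perp_pair =
  fixes Q :: "'a operad" and D P :: 'a
  assumes Q: "set_operad Q"
    and D [simp]: "D \<in> ops Q 2" and P [simp]: "P \<in> ops Q 2"
    and P_comm: "sact Q 2 (transpose 1 2) P = P"
    and DD: "pcomp Q 2 2 2 D D = pcomp Q 2 2 1 D D"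
    and DDop: "pcomp Q 2 2 2 D (sact Q 2 (transpose 1 2) D) = pcomp Q 2 2 1 D D"
    and DP: "pcomp Q 2 2 2 D P = pcomp Q 2 2 1 D D"
    and PD: "pcomp Q 2 2 2 P D = pcomp Q 2 2 1 D P"
    and PP: "pcomp Q 2 2 2 P P = pcomp Q 2 2 1 P P"
begin

lemma laws: "operad_law Q n a b \<Longrightarrow> a = b" and pre: "pre_operad Q"
  using Q unfolding set_operad_def by auto

lemmas closed = pre_operadD[OF pre]

lemma comp_closed: "a \<in> ops Q n \<Longrightarrow> b \<in> ops Q m \<Longrightarrow> i \<in> {1..n} \<Longrightarrow> n + m = Suc r \<Longrightarrow>
    pcomp Q n m i a b \<in> ops Q r"
  using closed(2)[of a n b m i] by simp

lemma assoc_first: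
  assumes "f \<in> ops Q 2" "b \<in> ops Q m" "c \<in> ops Q n" "j \<in> {1..m}" "m + n = Suc r"
  shows "pcomp Q (Suc m) n j (pcomp Q 2 m 1 f b) c = pcomp Q 2 r 1 f (pcomp Q m n j b c)"
  using laws[OF operad_law.sequential[of f Q 2 b m c n 1 j]] assms by simp

lemma assoc_second:
  assumes "f \<in> ops Q 2" "g \<in> ops Q 2" "c \<in> ops Q n"
  shows "pcomp Q 3 n 2 (pcomp Q 2 2 2 f g) c = pcomp Q 2 (Suc n) 2 f (pcomp Q 2 n 1 g c)"
  using laws[OF operad_law.sequential[of f Q 2 g 2 c n 2 1]] assms by (simp add: numeral_eq_Suc)

lemma exchange_inputs:
  assumes "f \<in> ops Q 2" "b \<in> ops Q m" "c \<in> ops Q n"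
  shows "pcomp Q (Suc m) n (Suc m) (pcomp Q 2 m 1 f b) c = pcomp Q (Suc n) m 1 (pcomp Q 2 n 2 f c) b"
  using laws[OF operad_law.parallel[of f Q 2 b m c n 1 2]] assms by simp

text \<open>
  The form in which each defining equation is used: if $x \mathbin{f} (y \mathbin{g} z) = (x \mathbin{g'} y) \mathbin{f'} z$,
  then the last step $c \mathbin{g} z$ of building the second argument of \<open>f\<close> becomes the outermost
  operation \<open>f'\<close>, and the smaller \<open>c\<close> is now the second argument of \<open>g'\<close>.  Thus inductions on the
  second argument go through without any permutation of the inputs.
\<close>

lemma slide_left:
  assumes eq: "pcomp Q 2 2 2 f g = pcomp Q 2 2 1 f' g'"
    and f: "f \<in> ops Q 2" "g \<in> ops Q 2" "f' \<in> ops Q 2" "g' \<in> ops Q 2" and c: "c \<in> ops Q n"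
  shows "pcomp Q 2 (Suc n) 2 f (pcomp Q 2 n 1 g c) = pcomp Q 2 (Suc n) 1 f' (pcomp Q 2 n 2 g' c)"
  using assoc_second[OF f(1,2) c] assoc_first[OF f(3,4) c, of 2 "Suc n"] eq by (simp add: numeral_eq_Suc)

lemma comp_unit_right: "a \<in> ops Q n \<Longrightarrow> i \<in> {1..n} \<Longrightarrow> pcomp Q n 1 i a (unit_op Q) = a"
  using laws[OF operad_law.unit_right] .

lemma comp_unit_left: "a \<in> ops Q n \<Longrightarrow> pcomp Q 1 n 1 (unit_op Q) a = a"
  using laws[OF operad_law.unit_left] .

lemma sact_id: "a \<in> ops Q n \<Longrightarrow> sact Q n id a = a"
  using laws[OF operad_law.act_id] .

lemma sact_comp:
  "a \<in> ops Q n \<Longrightarrow> \<sigma> permutes {1..n} \<Longrightarrow> \<tau> permutes {1..n} \<Longrightarrow>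
   sact Q n \<sigma> (sact Q n \<tau> a) = sact Q n (\<sigma> \<circ> \<tau>) a"
  using laws[OF operad_law.act_comp] by simp

lemma comp_sact:
  "a \<in> ops Q n \<Longrightarrow> b \<in> ops Q m \<Longrightarrow> i \<in> {1..n} \<Longrightarrow> \<sigma> permutes {1..n} \<Longrightarrow> \<tau> permutes {1..m} \<Longrightarrow>
   n + m = Suc r \<Longrightarrow>
   pcomp Q n m (\<sigma> i) (sact Q n \<sigma> a) (sact Q m \<tau> b) =
   sact Q r (block_perm m i \<sigma> \<tau>) (pcomp Q n m i a b)"
  using laws[OF operad_law.equivariance[of a Q n b m i \<sigma> \<tau>]] by simp


section \<open>Standard operations and their compositions\<close>

text \<open>
  The operation $x_1 \perp \dots \perp x_{k+1}$ of arity $k+1$; the shift makes the unit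
  the base case.
\<close>

primrec perp_power :: "nat \<Rightarrow> 'a" where
  "perp_power 0 = unit_op Q"
| "perp_power (Suc k) = pcomp Q 2 (Suc k) 1 P (perp_power k)"

text \<open>
  The operation $(x_1 \perp \dots \perp x_{k+1})\, x_{k+2} \cdots x_{k+1+l}$ of arity $k+1+l$.
\<close>

primrec std :: "nat \<Rightarrow> nat \<Rightarrow> 'a" where
  "std k 0 = perp_power k"
| "std k (Suc l) = pcomp Q 2 (Suc (k + l)) 1 D (std k l)"

lemma perp_power_in: "perp_power k \<in> ops Q (Suc k)"
proof (induction k)
  case 0
  then show ?case using closed(1) by simp
next
  case (Suc k)
  show ?case unfolding perp_power.simps by (rule comp_closed[OF P Suc]) auto
qed

lemma std_in: "std k l \<in> ops Q (Suc (k + l))"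
proof (induction l)
  case 0
  then show ?case using perp_power_in by simp
next
  case (Suc l)
  show ?case unfolding std.simps by (rule comp_closed[OF D Suc]) auto
qed

text \<open>
  Each operation of the second factor, whether $\perp$ or a product, becomes a product when it is
  slid out, so $x\, s_{k,l}(y_1, \dots, y_m) = x\, y_1 \cdots y_m$.
\<close>

lemma D_absorbs: "pcomp Q 2 (Suc (k + l)) 2 D (std k l) = std 0 (Suc (k + l))"
proof -
  have base: "pcomp Q 2 (Suc k) 2 D (perp_power k) = std 0 (Suc k)" for k
  proof (induction k)
    case 0
    then show ?case using comp_unit_right[OF D, of 1] comp_unit_right[OF D, of 2] by simp
  next
    case (Suc k)
    then show ?case using slide_left[OF DP D P D D perp_power_in] by simp
  qed
  show ?thesis
  proof (induction l)
    case 0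
    show ?case using base by simp
  next
    case (Suc l)
    then show ?case using slide_left[OF DD D D D D std_in] by simp
  qed
qed

text \<open>
  Here $x \perp ((y_1 \perp \dots)\, z_1 \cdots z_l) = (x \perp y_1 \perp \dots)\, z_1 \cdots z_l$;
  the inputs appear in the same order on both sides.  With \<open>x\<close> and $s_{k,l}$ exchanged a
  permutation would be needed.
\<close>

lemma P_second_std: "pcomp Q 2 (Suc (k + l)) 2 P (std k l) = std (Suc k) l"
proof -
  have base: "pcomp Q 2 (Suc k) 2 P (perp_power k) = perp_power (Suc k)" for k
  proof (induction k)
    case 0
    then show ?case using comp_unit_right[OF P, of 1] comp_unit_right[OF P, of 2] by simp
  next
    case (Suc k)
    then show ?case using slide_left[OF PP P P P P perp_power_in] by simp
  qed
  show ?thesis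
  proof (induction l)
    case 0
    show ?case using base by simp
  next
    case (Suc l)
    then show ?case using slide_left[OF PD P D D P std_in] by simp
  qed
qed

lemma std_0_comp: "pcomp Q (Suc m) (Suc (k + l)) 1 (std 0 m) (std k l) = std k (l + m)"
proof (induction m)
  case 0
  then show ?case using comp_unit_left[OF std_in] by simp
next
  case (Suc m)
  then show ?case using assoc_first[OF D std_in std_in, of 1 0 m k l "Suc (k + (l + m))"]
    by (simp add: add_ac)
qed

lemma std_comp_perp_power:
  "pcomp Q (Suc (k + l)) (Suc k') 1 (std k l) (perp_power k') = std (k + k') l"
proof (induction l)
  case 0
  show ?case
  proof (induction k)
    case 0
    then show ?case using comp_unit_left[OF perp_power_in] by simp
  next
    case (Suc k)
    then show ?case using assoc_first[OF P perp_power_in perp_power_in, of 1 k k' "Suc (k + k')"]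
      by simp
  qed
next
  case (Suc l)
  then show ?case using assoc_first[OF D std_in perp_power_in, of 1 k l k' "Suc (k + k' + l)"]
    by (simp add: add_ac)
qed


section \<open>Normal forms\<close>

definition normal :: "nat \<Rightarrow> 'a set" where
  "normal n = {sact Q n \<sigma> (std k l) |\<sigma> k l. \<sigma> permutes {1..n} \<and> n = Suc (k + l)}"

lemma normalI: "\<sigma> permutes {1..n} \<Longrightarrow> n = Suc (k + l) \<Longrightarrow> sact Q n \<sigma> (std k l) \<in> normal n"
  unfolding normal_def by blast

lemma normalE:
  assumes "x \<in> normal n"
  obtains \<sigma> k l where "\<sigma> permutes {1..n}" "n = Suc (k + l)" "x = sact Q n \<sigma> (std k l)"
  using assms unfolding normal_def by blast

lemma normal_in_ops: "x \<in> normal n \<Longrightarrow> x \<in> ops Q n"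
  using closed(3) std_in by (metis normalE)

lemma std_normal: "n = Suc (k + l) \<Longrightarrow> std k l \<in> normal n"
  using normalI[OF permutes_id, of n k l] sact_id[OF std_in] by (simp add: id_def)

lemma normal_sact: "x \<in> normal n \<Longrightarrow> \<sigma> permutes {1..n} \<Longrightarrow> sact Q n \<sigma> x \<in> normal n"
  by (metis normalE normalI permutes_compose sact_comp std_in)

text \<open>
  By equivariance, permutations of the inputs of the two arguments of a partial composition only
  permute the inputs of the result.
\<close>

lemma comp_sact_normal:
  assumes a: "a \<in> ops Q n" and b: "b \<in> ops Q m" and i: "i \<in> {1..n}"
    and s: "\<sigma> permutes {1..n}" and t: "\<tau> permutes {1..m}" and r: "n + m = Suc r"
    and nf: "pcomp Q n m i a b \<in> normal r"
  shows "pcomp Q n m (\<sigma> i) (sact Q n \<sigma> a) (sact Q m \<tau> b) \<in> normal r"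
  unfolding comp_sact[OF a b i s t r]
  using nf block_perm_permutes[OF s t i] r by (intro normal_sact) simp_all

lemma D_first_normal:
  assumes "x \<in> normal n"
  shows "pcomp Q 2 n 1 D x \<in> normal (Suc n)"
proof -
  obtain \<tau> k l where x: "\<tau> permutes {1..n}" "n = Suc (k + l)" "x = sact Q n \<tau> (std k l)"
    using assms by (rule normalE)
  have "pcomp Q 2 n 1 D (std k l) \<in> normal (Suc n)"
    using std_normal[of "Suc n" k "Suc l"] x(2) by simp
  then have "pcomp Q 2 n (id 1) (sact Q 2 id D) (sact Q n \<tau> (std k l)) \<in> normal (Suc n)"
    using x std_in by (intro comp_sact_normal[OF D]) (auto simp: permutes_def)
  then show ?thesis using x sact_id[OF D] by simp
qed

text \<open>
  Commutativity of \<open>P\<close> turns a composition at the first input into one at the second input, at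
  the cost of a permutation.
\<close>

lemma P_first_normal:
  assumes "x \<in> normal n"
  shows "pcomp Q 2 n 1 P x \<in> normal (Suc n)"
proof -
  obtain \<tau> k l where x: "\<tau> permutes {1..n}" "n = Suc (k + l)" "x = sact Q n \<tau> (std k l)"
    using assms by (rule normalE)
  have "pcomp Q 2 n 2 P (std k l) \<in> normal (Suc n)"
    using std_normal[of "Suc n" "Suc k" l] P_second_std[of k l] x(2) by simp
  then have "pcomp Q 2 n (transpose 1 2 2) (sact Q 2 (transpose 1 2) P) (sact Q n \<tau> (std k l)) \<in> normal (Suc n)"
    using x std_in by (intro comp_sact_normal[OF P]) (auto intro: permutes_swap_id)
  then show ?thesis using x P_comm by simp
qed

text \<open>
  The outermost operation of $s_{k,l}$ has a single input of the whole as its second argument.  If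
  \<open>i\<close> is that last input, the result is an explicit standard operation; otherwise the composition
  takes place inside the first argument, and the outermost operation is applied afterwards.
\<close>

lemma std_comp_std:
  assumes "i \<in> {1..Suc (k + l)}"
  shows "pcomp Q (Suc (k + l)) (Suc (k' + l')) i (std k l) (std k' l') \<in> normal (Suc (k + l + k' + l'))"
  using assms
proof (induction l arbitrary: i)
  case 0
  then show ?case
  proof (induction k arbitrary: i)
    case 0
    then show ?case using comp_unit_left[OF std_in] std_normal[of "Suc (k' + l')" k' l'] by simp
  next
    case (Suc k)
    show ?case
    proof (cases "i = Suc (Suc k)")
      case True
      then show ?thesis
        using exchange_inputs[OF P perp_power_in std_in, of k k' l'] P_second_std[of k' l']
          std_comp_perp_power[of "Suc k'" l' k] std_normal[of "Suc (Suc (k + k' + l'))" "Suc (k' + k)" l']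
        by (simp add: add_ac)
    next
      case False
      then have i: "i \<in> {1..Suc k}" using Suc.prems by auto
      show ?thesis
        using assoc_first[OF P perp_power_in std_in i, of k' l' "Suc (k + k' + l')"]
          P_first_normal[OF Suc.IH] i by (simp add: add_ac)
    qed
  qed
next
  case (Suc l)
  show ?case
  proof (cases "i = Suc (Suc (k + l))")
    case True
    then show ?thesis
      using exchange_inputs[OF D std_in std_in, of k l k' l'] D_absorbs[of k' l']
        std_0_comp[of "Suc (k' + l')" k l]
        std_normal[of "Suc (Suc (k + l + k' + l'))" k "l + Suc (k' + l')"]
      by (simp add: add_ac)
  next
    case False
    then have i: "i \<in> {1..Suc (k + l)}" using Suc.prems by auto
    show ?thesis
      using assoc_first[OF D std_in std_in i, of k' l' "Suc (k + l + k' + l')"]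
        D_first_normal[OF Suc.IH] i by (simp add: add_ac)
  qed
qed

lemma normal_comp:
  assumes "x \<in> normal n" "y \<in> normal m" "i \<in> {1..n}"
  shows "pcomp Q n m i x y \<in> normal (n + m - 1)"
proof -
  obtain \<sigma> k l where x: "\<sigma> permutes {1..n}" "n = Suc (k + l)" "x = sact Q n \<sigma> (std k l)"
    using assms(1) by (rule normalE)
  obtain \<tau> k' l' where y: "\<tau> permutes {1..m}" "m = Suc (k' + l')" "y = sact Q m \<tau> (std k' l')"
    using assms(2) by (rule normalE)
  obtain j where j: "j \<in> {1..n}" "\<sigma> j = i"
    using permutes_image[OF x(1)] assms(3) by (metis imageE)
  have "pcomp Q n m (\<sigma> j) (sact Q n \<sigma> (std k l)) (sact Q m \<tau> (std k' l')) \<in> normal (n + m - 1)"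
    using x y j std_in std_comp_std[of j k l k' l']
    by (intro comp_sact_normal) (simp_all add: add_ac)
  then show ?thesis using x y j by simp
qed

lemma unit_normal: "unit_op Q \<in> normal 1"
  using std_normal[of 1 0 0] by simp

lemma D_normal: "D \<in> normal 2"
  using std_normal[of 2 0 1] comp_unit_right[OF D, of 1] by simp

lemma P_normal: "P \<in> normal 2"
  using std_normal[of 2 1 0] comp_unit_right[OF P, of 1] by simp


section \<open>Symmetries of standard operations\<close>

lemma sact_first:
  assumes "f \<in> ops Q 2" "b \<in> ops Q m" "\<tau> permutes {1..m}" "sact Q m \<tau> b = b"
  shows "sact Q (Suc m) \<tau> (pcomp Q 2 m 1 f b) = pcomp Q 2 m 1 f b"
  using comp_sact[OF assms(1,2) _ permutes_id assms(3), of 1 "Suc m"]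
    block_perm_first_input[OF assms(3)] assms(4) sact_id[OF assms(1)] by (simp add: id_def)

text \<open>
  If $(x \mathbin{f} y) \mathbin{f} z = x \mathbin{f} (y \mathbin{g} z) = x \mathbin{f} (z \mathbin{g} y)$,
  then $y$ and $z$ can be exchanged on the left.  This applies to \<open>f = g = P\<close>, because $\perp$ is
  commutative, and to \<open>f = g = D\<close>, because the product becomes commutative inside a second
  factor.
\<close>

lemma sact_last_pair:
  assumes f: "f \<in> ops Q 2" and g: "g \<in> ops Q 2"
    and eq: "pcomp Q 2 2 1 f f = pcomp Q 2 2 2 f g"
    and eq': "pcomp Q 2 2 1 f f = pcomp Q 2 2 2 f (sact Q 2 (transpose 1 2) g)"
    and c: "c \<in> ops Q m"
  shows "sact Q (Suc (Suc m)) (transpose (Suc m) (Suc (Suc m)))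
      (pcomp Q 2 (Suc m) 1 f (pcomp Q 2 m 1 f c)) = pcomp Q 2 (Suc m) 1 f (pcomp Q 2 m 1 f c)"
proof -
  let ?ff = "pcomp Q 2 2 1 f f"
  have ff: "?ff \<in> ops Q 3" by (rule comp_closed[OF f f]) auto
  have t: "transpose 2 3 permutes {1..3::nat}" "transpose 1 2 permutes {1..2::nat}"
    by (auto intro: permutes_swap_id)
  \<comment> \<open>Acting on \<open>g\<close>, substituted at the second input of \<open>f\<close>, moves its two inputs to positions 2 and 3.\<close>
  have bp: "block_perm 2 2 id (transpose 1 2) = (transpose 2 3 :: nat \<Rightarrow> nat)"
  proof
    fix p :: nat
    consider "p = 0" | "p = 1" | "p = 2" | "p = 3" | "p > 3" by linarith
    then show "block_perm 2 2 id (transpose 1 2) p = transpose 2 3 p"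
      by cases (auto simp: block_perm_def outer_slot_def transpose_def)
  qed
  have inv: "sact Q 3 (transpose 2 3) ?ff = ?ff"
    using comp_sact[OF f g _ permutes_id t(2), of 2 3] sact_id[OF f] bp eq eq' by (simp add: id_def)
  have "pcomp Q 3 m 1 ?ff c = sact Q (Suc (Suc m)) (transpose (Suc m) (Suc (Suc m))) (pcomp Q 3 m 1 ?ff c)"
    using comp_sact[OF ff c _ t(1) permutes_id, of 1 "Suc (Suc m)"] sact_id[OF c]
      block_perm_swap_later_inputs[of m] inv by (simp add: id_def)
  moreover have "pcomp Q 3 m 1 ?ff c = pcomp Q 2 (Suc m) 1 f (pcomp Q 2 m 1 f c)"
    using assoc_first[OF f f c, of 1 "Suc m"] by (simp add: numeral_eq_Suc)
  ultimately show ?thesis by simp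
qed

text \<open>
  The excluded transposition exchanges the last input joined by $\perp$ with the first factor
  that multiplies.
\<close>

lemma sact_adjacent:
  assumes "i \<in> {1..k + l}" "i \<noteq> Suc k"
  shows "sact Q (Suc (k + l)) (transpose i (Suc i)) (std k l) = std k l"
  using assms
proof (induction l)
  case 0
  then show ?case
  proof (induction k)
    case (Suc k)
    show ?case
    proof (cases "i = Suc k")
      case True
      show ?thesis
      proof (cases k)
        case 0
        then show ?thesis using True P_comm comp_unit_right[OF P, of 1] by (simp add: numeral_2_eq_2)
      next
        case (Suc k')
        then show ?thesis
          using True sact_last_pair[OF P P, of "perp_power k'" "Suc k'"] PP P_comm perp_power_in by simp
      qed
    next
      case False
      then show ?thesis
        using Suc sact_first[OF P perp_power_in, of "transpose i (Suc i)" k]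
        by (auto simp: permutes_swap_id)
    qed
  qed simp
next
  case (Suc l)
  show ?case
  proof (cases "i = Suc (k + l)")
    case True
    then obtain l' where "l = Suc l'" using Suc.prems by (cases l) auto
    then show ?thesis
      using True sact_last_pair[OF D D, of "std k l'" "Suc (k + l')"] DD DDop std_in by simp
  next
    case False
    then show ?thesis
      using Suc sact_first[OF D std_in, of "transpose i (Suc i)" k l]
      by (auto simp: permutes_swap_id)
  qed
qed

lemma sact_transpose:
  assumes "1 \<le> a" "a < b" "b \<le> Suc (k + l)" "b \<le> Suc k \<or> Suc k < a"
  shows "sact Q (Suc (k + l)) (transpose a b) (std k l) = std k l"
proof -
  let ?n = "Suc (k + l)"
  have "Suc a \<le> b" using assms(2) by simp
  then show ?thesis using assms(3,4)
  proof (induction rule: dec_induct)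
    case base
    then show ?case using assms(1) by (intro sact_adjacent) auto
  next
    case (step b)
    let ?s = "transpose b (Suc b)" and ?t = "transpose a b"
    have perms: "?s permutes {1..?n}" "?t permutes {1..?n}"
      using step.hyps step.prems assms(1) by (auto intro: permutes_swap_id)
    \<comment> \<open>Conjugation by the adjacent transposition moves \<open>b\<close> to \<open>Suc b\<close> and fixes \<open>a\<close>.\<close>
    have "transpose a (Suc b) = ?s \<circ> (?t \<circ> ?s)"
      using step.hyps by (auto simp: fun_eq_iff transpose_def)
    then have "sact Q ?n (transpose a (Suc b)) (std k l) =
        sact Q ?n ?s (sact Q ?n ?t (sact Q ?n ?s (std k l)))"
      using perms by (simp add: sact_comp std_in closed(3) permutes_compose)
    also have "sact Q ?n ?s (std k l) = std k l"
      using step.hyps step.prems assms(1) by (intro sact_adjacent) auto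
    finally show ?case using step sact_adjacent[of b k l] by auto
  qed
qed

text \<open>
  The two blocks are the inputs joined by $\perp$ and the factors that multiply.
\<close>

lemma sact_block:
  assumes "\<rho> permutes S" and S: "S = {1..Suc k} \<or> S = {Suc (Suc k)..Suc (k + l)}"
  shows "sact Q (Suc (k + l)) \<rho> (std k l) = std k l"
proof -
  have "finite S" using S by auto
  have sub: "S \<subseteq> {1..Suc (k + l)}" using S by auto
  from assms(1) \<open>finite S\<close> show ?thesis
  proof (induction rule: permutes_induct)
    case id
    show ?case by (rule sact_id[OF std_in])
  next
    case (swap a b p)
    have p: "p permutes {1..Suc (k + l)}" by (rule permutes_subset[OF swap(4) sub])
    have t: "transpose a b permutes {1..Suc (k + l)}"
      using swap(1,2) sub by (intro permutes_swap_id) auto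
    have "sact Q (Suc (k + l)) (transpose a b) (std k l) = std k l"
      using swap(1-3) S sact_transpose[of a b k l] sact_transpose[of b a k l]
      by (cases "a < b") (auto simp: transpose_commute)
    then show ?case
      using sact_comp[OF std_in t p] swap(5) by metis
  qed
qed

text \<open>
  A permutation that preserves the first block preserves the second one as well, and so it is a
  product of a permutation of the first and a permutation of the second.
\<close>

lemma sact_stabilizer:
  assumes r: "\<rho> permutes {1..Suc (k + l)}" and img: "\<rho> ` {1..Suc k} = {1..Suc k}"
  shows "sact Q (Suc (k + l)) \<rho> (std k l) = std k l"
proof -
  let ?A = "{1..Suc k}" and ?B = "{Suc (Suc k)..Suc (k + l)}"
  define \<rho>1 where "\<rho>1 x = (if x \<in> ?A then \<rho> x else x)" for x
  define \<rho>2 where "\<rho>2 x = (if x \<in> ?B then \<rho> x else x)" for x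
  have inj: "inj \<rho>" using permutes_inj[OF r] .
  have B: "?B = {1..Suc (k + l)} - ?A" by auto
  have imgB: "\<rho> ` ?B = ?B"
    unfolding B image_set_diff[OF inj] permutes_image[OF r] img ..
  have 1: "\<rho>1 permutes ?A"
    unfolding \<rho>1_def[abs_def] using inj_on_subset[OF inj] img
    by (intro restriction_permutes bij_betw_imageI) simp_all
  have 2: "\<rho>2 permutes ?B"
    unfolding \<rho>2_def[abs_def] using inj_on_subset[OF inj] imgB
    by (intro restriction_permutes bij_betw_imageI) simp_all
  have "\<rho> = \<rho>1 \<circ> \<rho>2"
  proof
    fix x
    consider "x \<in> ?A" | "x \<in> ?B" | "x \<notin> {1..Suc (k + l)}" unfolding B by blast
    then show "\<rho> x = (\<rho>1 \<circ> \<rho>2) x"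
    proof cases
      case 1
      then show ?thesis by (simp add: \<rho>1_def \<rho>2_def)
    next
      case 2
      then have "\<rho> x \<in> ?B" using imgB by blast
      then show ?thesis using 2 by (simp add: \<rho>1_def \<rho>2_def)
    next
      case 3
      then have "x \<notin> ?A" "x \<notin> ?B" by auto
      then show ?thesis using permutes_not_in[OF r 3] by (simp only: \<rho>1_def \<rho>2_def o_def if_False)
    qed
  qed
  moreover have "sact Q (Suc (k + l)) \<rho>1 (std k l) = std k l" "sact Q (Suc (k + l)) \<rho>2 (std k l) = std k l"
    using sact_block[OF 1] sact_block[OF 2] by simp_all
  moreover have "\<rho>1 permutes {1..Suc (k + l)}" "\<rho>2 permutes {1..Suc (k + l)}"
    by (rule permutes_subset[OF 1], simp) (rule permutes_subset[OF 2], simp)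
  ultimately show ?thesis using sact_comp[OF std_in, of \<rho>1 k l \<rho>2] by simp
qed

lemma sact_std_cong:
  assumes s: "\<sigma> permutes {1..Suc (k + l)}" and t: "\<tau> permutes {1..Suc (k + l)}"
    and img: "\<sigma> ` {1..Suc k} = \<tau> ` {1..Suc k}"
  shows "sact Q (Suc (k + l)) \<sigma> (std k l) = sact Q (Suc (k + l)) \<tau> (std k l)"
proof -
  define \<rho> where "\<rho> = inv \<tau> \<circ> \<sigma>"
  have \<rho>: "\<rho> permutes {1..Suc (k + l)}"
    unfolding \<rho>_def by (intro permutes_compose s permutes_inv t)
  have "\<rho> ` {1..Suc k} = {1..Suc k}"
    unfolding \<rho>_def image_comp[symmetric] img
    by (simp add: image_comp permutes_inv_o[OF t])
  then have "sact Q (Suc (k + l)) \<rho> (std k l) = std k l" by (rule sact_stabilizer[OF \<rho>])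
  moreover have "\<sigma> = \<tau> \<circ> \<rho>"
    by (simp add: \<rho>_def o_assoc permutes_inv_o[OF t])
  ultimately show ?thesis using sact_comp[OF std_in t \<rho>] by simp
qed


section \<open>Morphisms to the operad of subsets\<close>

context
  fixes \<phi>
  assumes hom: "operad_hom Q (subset_operad perm_operad) \<phi>"
    and \<phi>_D: "\<phi> 2 D = {1}" and \<phi>_P: "\<phi> 2 P = {1, 2}"
begin

lemma hom_comp:
  "f \<in> ops Q 2 \<Longrightarrow> b \<in> ops Q m \<Longrightarrow>
   \<phi> (Suc m) (pcomp Q 2 m 1 f b) = pcomp (subset_operad perm_operad) 2 m 1 (\<phi> 2 f) (\<phi> m b)"
  using operad_homD(3)[OF hom, of f 2 b m 1] by simp

text \<open>
  Composing with $\{1\}$ at its first input leaves a subset unchanged, and composing with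
  $\{1,2\}$ adds the new last input to it.
\<close>

lemma hom_std: "\<phi> (Suc (k + l)) (std k l) = {1..Suc k}"
proof (induction l)
  case 0
  show ?case
  proof (induction k)
    case 0
    then show ?case
      using hom unfolding operad_hom_def by (auto simp: subset_operad_def perm_operad_def)
  next
    case (Suc k)
    have "pcomp (subset_operad perm_operad) 2 (Suc k) 1 {1, 2} {1..Suc k} = {1..Suc (Suc k)}"
      unfolding subset_perm_comp by auto
    then show ?case
      using hom_comp[OF P perp_power_in, of k] Suc \<phi>_P by simp
  qed
next
  case (Suc l)
  have "pcomp (subset_operad perm_operad) 2 (Suc (k + l)) 1 {1} {1..Suc k} = {1..Suc k}"
    unfolding subset_perm_comp by auto
  then show ?case using hom_comp[OF D std_in, of k l] Suc \<phi>_D by simp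
qed

lemma hom_sact_std:
  assumes "\<sigma> permutes {1..Suc (k + l)}"
  shows "\<phi> (Suc (k + l)) (sact Q (Suc (k + l)) \<sigma> (std k l)) = \<sigma> ` {1..Suc k}"
  using hom std_in assms hom_std
  unfolding operad_hom_def by (simp add: subset_operad_def perm_operad_def)

text \<open>
  The cardinality of the image recovers \<open>k\<close>, and then the image itself recovers the operation.
\<close>

lemma inj_on_normal: "inj_on (\<phi> n) (normal n)"
proof (rule inj_onI)
  fix x y assume "x \<in> normal n" "y \<in> normal n" and eq: "\<phi> n x = \<phi> n y"
  then obtain \<sigma> k l \<tau> k' l' where
    x: "\<sigma> permutes {1..n}" "n = Suc (k + l)" "x = sact Q n \<sigma> (std k l)" and
    y: "\<tau> permutes {1..n}" "n = Suc (k' + l')" "y = sact Q n \<tau> (std k' l')"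
    by (metis normalE)
  have img: "\<sigma> ` {1..Suc k} = \<tau> ` {1..Suc k'}"
    using eq hom_sact_std[of \<sigma> k l] hom_sact_std[of \<tau> k' l'] x y by simp
  then have "card (\<sigma> ` {1..Suc k}) = card (\<tau> ` {1..Suc k'})" by simp
  then have "k = k'"
    using permutes_inj_on[OF x(1)] permutes_inj_on[OF y(1)] by (simp add: card_image)
  then show "x = y" using sact_std_cong[of \<sigma> k l \<tau>] x y img by simp
qed

lemma normal_onto:
  assumes "A \<in> ops (subset_operad perm_operad) n"
  shows "A \<in> \<phi> n ` normal n"
proof -
  have A: "A \<subseteq> {1..n}" "A \<noteq> {}" using assms by (auto simp: subset_operad_def perm_operad_def)
  then have "finite A" using finite_subset by auto
  then have "card A > 0" "card A \<le> n" using A card_mono[of "{1..n}" A] by (auto simp: card_gt_0_iff)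
  then obtain k l where k: "card A = Suc k" "n = Suc (k + l)"
    by (metis Suc_pred' add_Suc le_Suc_ex)
  obtain g where g: "bij_betw g {1..Suc k} A"
    using finite_same_card_bij[of "{1..Suc k}" A] k \<open>finite A\<close> by auto
  obtain h where h: "bij_betw h {Suc (Suc k)..n} ({1..n} - A)"
    using finite_same_card_bij[of "{Suc (Suc k)..n}" "{1..n} - A"] k A \<open>finite A\<close>
    by (auto simp: card_Diff_subset)
  define \<sigma> where "\<sigma> x = (if x \<in> {1..Suc k} then g x else if x \<in> {1..n} then h x else x)" for x
  have 1: "bij_betw \<sigma> {1..Suc k} A" using g by (rule bij_betw_cong[THEN iffD1, rotated]) (simp add: \<sigma>_def)
  have 2: "bij_betw \<sigma> {Suc (Suc k)..n} ({1..n} - A)"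
    using h by (rule bij_betw_cong[THEN iffD1, rotated]) (simp add: \<sigma>_def)
  have "bij_betw \<sigma> ({1..Suc k} \<union> {Suc (Suc k)..n}) (A \<union> ({1..n} - A))"
    by (rule bij_betw_combine[OF 1 2]) auto
  moreover have "{1..Suc k} \<union> {Suc (Suc k)..n} = {1..n}" "A \<union> ({1..n} - A) = {1..n}"
    using k A by auto
  ultimately have "\<sigma> permutes {1..n}"
    using k by (intro bij_imp_permutes) (auto simp: \<sigma>_def)
  moreover from this have "\<phi> n (sact Q n \<sigma> (std k l)) = A"
    using hom_sact_std[of \<sigma> k l] k 1 by (simp add: bij_betw_def)
  ultimately show ?thesis using normalI k by blast
qed

lemma iso_if_normal:
  assumes "\<And>n. ops Q n \<subseteq> normal n"
  shows "operad_iso Q (subset_operad perm_operad) \<phi>"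
proof -
  have "ops Q n = normal n" for n using assms normal_in_ops by blast
  moreover have "\<phi> n ` ops Q n \<subseteq> ops (subset_operad perm_operad) n" for n
    using operad_homD(1)[OF hom] by blast
  moreover have "ops (subset_operad perm_operad) n \<subseteq> \<phi> n ` normal n" for n
    using normal_onto by blast
  ultimately have "bij_betw (\<phi> n) (ops Q n) (ops (subset_operad perm_operad) n)" for n
    using inj_on_normal[of n] unfolding bij_betw_def by (metis subset_antisym)
  then show ?thesis using hom by (simp add: operad_iso_def)
qed

end

end


section \<open>The commutative triassociative operad\<close>

abbreviation trias_free :: "trias_gen opterm set operad" where
  "trias_free \<equiv> free_operad trias_collection"

definition ct_class :: "nat \<Rightarrow> trias_gen opterm set \<Rightarrow> trias_gen opterm set set" where
  "ct_class n a = cong_rel trias_free trias_relation n `` {a}"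

abbreviation ct_gen :: "trias_gen \<Rightarrow> trias_gen opterm set set" where
  "ct_gen g \<equiv> ct_class 2 (free_gen trias_collection 2 g)"

lemma pre_operad_trias_free: "pre_operad trias_free"
  using set_operad_free_operad unfolding set_operad_def by blast

lemma hom_ct_class: "operad_hom trias_free com_trias ct_class"
  using operad_hom_quotient_operad[OF pre_operad_trias_free, of trias_relation]
  unfolding com_trias_def ct_class_def[abs_def] by simp

lemma free_gen_trias: "free_gen trias_collection 2 g \<in> ops trias_free 2"
  by (rule free_gen_in_ops) (cases g; simp add: trias_collection_def)

lemma ct_gen_in_ops: "ct_gen g \<in> ops com_trias 2"
  using hom_ct_class free_gen_trias by (simp add: operad_hom_def)

lemma ct_gen_flip: "sact com_trias 2 (transpose 1 2) (ct_gen g) = ct_gen (flip_gen g)"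
proof -
  have t: "transpose 1 2 permutes {1..2::nat}" by (rule permutes_swap_id) auto
  have "sact trias_free 2 (transpose 1 2) (free_gen trias_collection 2 g) = free_gen trias_collection 2 (flip_gen g)"
    using free_gen_equivariant[of g trias_collection 2 "transpose 1 2"] t
    by (cases g) (auto simp: trias_collection_def)
  then show ?thesis using hom_ct_class free_gen_trias t unfolding operad_hom_def by metis
qed

lemma ct_gen_comp:
  "i \<in> {1..2} \<Longrightarrow> pcomp com_trias 2 2 i (ct_gen f) (ct_gen g) = ct_class 3 (trias_comp f i g)"
  using operad_homD(3)[OF hom_ct_class free_gen_trias free_gen_trias] unfolding trias_comp_def by simp

lemma trias_relation_imp_class_eq: "trias_relation n a b \<Longrightarrow> ct_class n a = ct_class n b"
  using trias_relation_imp_cong[of n a b] gen_cong_closed[OF pre_operad_trias_free]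
  unfolding ct_class_def by (subst cong_class_eq_iff[OF pre_operad_trias_free]) blast+

lemmas ct_gen_relations = trias_relation.intros[THEN trias_relation_imp_class_eq]

interpretation ct: perm_perp_pair com_trias "ct_gen Dashv" "ct_gen Perp"
  by standard (simp_all add: set_operad_com_trias ct_gen_in_ops ct_gen_flip[simplified]
      ct_gen_comp[simplified] ct_gen_relations(1-3,10,11)[simplified])

text \<open>
  The operad is generated by the classes of $\dashv, \vdash, \perp$, and normal forms are closed
  under the operations of the operad.
\<close>

lemma com_trias_normal: "ops com_trias n \<subseteq> ct.normal n"
proof
  fix x assume "x \<in> ops com_trias n"
  then obtain a where a: "a \<in> ops trias_free n" "x = ct_class n a"
    unfolding com_trias_def ct_class_def by (rule quotient_operad_classE)
  from a(1) have "ct_class n a \<in> ct.normal n"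
  proof (induction rule: free_operad_induct)
    case unit
    then show ?case using ct.unit_normal hom_ct_class by (simp add: operad_hom_def)
  next
    case (gen n g)
    have "ct_gen Vdash \<in> ct.normal 2"
      using ct.normal_sact[OF ct.D_normal permutes_swap_id[of 1 "{1..2}" 2]] ct_gen_flip[of Dashv] by simp
    then have "ct_gen g \<in> ct.normal 2" using ct.D_normal ct.P_normal by (cases g) auto
    then show ?case using gen by (auto simp: trias_collection_def split: if_splits)
  next
    case (comp n m i a b)
    then show ?case using ct.normal_comp hom_ct_class unfolding operad_hom_def by metis
  next
    case (act n \<sigma> a)
    then show ?case using ct.normal_sact hom_ct_class unfolding operad_hom_def by metis
  qed
  then show "x \<in> ct.normal n" using a by simp
qed

fun gen_subset :: "trias_gen \<Rightarrow> nat set" where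
  "gen_subset Dashv = {1}"
| "gen_subset Vdash = {2}"
| "gen_subset Perp = {1, 2}"

text \<open>
  The transposition exchanges $\{1\}$ and $\{2\}$ and fixes $\{1,2\}$, which gives the morphism on
  the free operad; it descends because both sides of each relation have the same value, a subset of
  $\{1,2,3\}$.
\<close>

lemma com_trias_hom_exists:
  "\<exists>\<phi>. operad_hom com_trias (subset_operad perm_operad) \<phi> \<and> (\<forall>g. \<phi> 2 (ct_gen g) = gen_subset g)"
proof -
  let ?S = "subset_operad perm_operad"
  have act: "gen_subset (gact trias_collection n \<sigma> g) = sact ?S n \<sigma> (gen_subset g)"
    if "g \<in> gens trias_collection n" "\<sigma> permutes {1..n}" for n g \<sigma>
  proof -
    have n: "n = 2" using that(1) by (auto simp: trias_collection_def split: if_splits)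
    have "{1..n} = {1, 2}" using n by auto
    then have "\<sigma> = id \<or> \<sigma> = transpose 1 2" using that(2) permutes_doubleton_iff by metis
    moreover have "id \<noteq> (transpose 1 2 :: nat \<Rightarrow> nat)" by (auto simp: fun_eq_iff transpose_def)
    ultimately show ?thesis
      by (cases g) (auto simp: n trias_collection_def subset_operad_def perm_operad_def)
  qed
  have "\<exists>\<phi>. operad_hom trias_free ?S \<phi> \<and>
      (\<forall>n. \<forall>g\<in>gens trias_collection n. \<phi> n (free_gen trias_collection n g) = gen_subset g)"
  proof (rule free_operad_universal)
    show "set_operad ?S" by (intro set_operad_subset_operad set_operad_perm_operad)
    show "gen_subset g \<in> ops ?S n" if "g \<in> gens trias_collection n" for n g
      using that by (cases g) (auto simp: trias_collection_def subset_operad_def perm_operad_def split: if_splits)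
  qed (rule act)
  then obtain \<phi> where \<phi>: "operad_hom trias_free ?S \<phi>"
      "\<And>g. \<phi> 2 (free_gen trias_collection 2 g) = gen_subset g"
    by (fastforce simp: trias_collection_def intro: trias_gen.exhaust)
  have comp: "\<phi> 3 (trias_comp f i g) = pcomp ?S 2 2 i (gen_subset f) (gen_subset g)" if "i \<in> {1..2}" for f i g
    using operad_homD(3)[OF \<phi>(1) free_gen_trias free_gen_trias that] \<phi>(2) unfolding trias_comp_def by simp
  have rel: "\<phi> n a = \<phi> n b" if "trias_relation n a b" for n a b
    using that by cases (auto simp: comp[simplified] subset_perm_comp numeral_2_eq_2)
  have "\<exists>\<psi>. operad_hom com_trias ?S \<psi> \<and>
      (\<forall>n. \<forall>a\<in>ops trias_free n. \<psi> n (ct_class n a) = \<phi> n a)"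
    unfolding com_trias_def ct_class_def
    by (rule quotient_operad_universal[OF pre_operad_trias_free \<phi>(1)]) (rule rel)
  then show ?thesis using \<phi>(2) free_gen_trias by metis
qed

theorem proposition2p16:
  shows "isomorphic_set_operads (subset_operad perm_operad) com_trias"
proof -
  obtain \<phi> where "operad_hom com_trias (subset_operad perm_operad) \<phi>"
    "\<And>g. \<phi> 2 (ct_gen g) = gen_subset g"
    using com_trias_hom_exists by blast
  then have "operad_iso com_trias (subset_operad perm_operad) \<phi>"
    using com_trias_normal by (intro ct.iso_if_normal) simp_all
  then have "\<exists>\<psi>. operad_iso (subset_operad perm_operad) com_trias \<psi>"
    using operad_iso_inverse[OF ct.pre] by blast
  then show ?thesis
    unfolding isomorphic_set_operads_def
    using set_operad_subset_operad[OF set_operad_perm_operad] set_operad_com_trias by blast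
qed

end
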